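(* $\Delta_2(\ker\Delta_1)=\Delta_2(\ker\Delta_0)=\ell_f^*$.
   Context: All spaces are complex. For the couple $(X_0,X_1)=(\ell_\infty,\ell_1)$ put $\Sigma=\ell_\infty+\ell_1$. The Calderón space $\mathcal C$ of the couple is the Banach space of bounded continuous functions $F:\{z\in\mathbb C:0\le \mathrm{Re}\,z\le 1\}\to\Sigma$, analytic on the open strip, such that for $j=0,1$ the map $t\mapsto F(j+it)$ is continuous from $\mathbb R$ into $X_j$ and tends to $0$ as $|t|\to\infty$, with norm $\|F\|=\max_{j=0,1}\sup_{t}\|F(j+it)\|_{X_j}$. For $k=0,1,2$ let $\Delta_k:\mathcal C\to\Sigma$, $\Delta_k(F)=F^{(k)}(1/2)/k!$. $\ell_f$ is the Orlicz sequence space of the Orlicz function which near $0$ is $f(t)=t^2\log^2t$; that is, $\ell_f=\{x\in\ell_2:x\log|x|\in\ell_2\}$. Its dual $\ell_f^*$ is regarded as a sequence space through the pairing $\langle x,y\rangle=\sum_n x_ny_n$. The space $T(K)$ carries the quotient norm $\|x\|=\inf\{\|F\|:F\in K,\ TF=x\}$, and equality means equality of sets of sequences with equivalence of norms. *)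

theory Defs
  imports "HOL-Analysis.Analysis"
begin

text \<open>
  A normed space of complex sequences is given by its set of elements and its norm; the
  value of \<open>nrm\<close> outside \<open>elems\<close> carries no meaning.
\<close>

record seq_space =
  elems :: "(nat \<Rightarrow> complex) set"
  nrm :: "(nat \<Rightarrow> complex) \<Rightarrow> real"

definition seq_space_eq :: "seq_space \<Rightarrow> seq_space \<Rightarrow> bool" (infix "\<cong>\<^sub>s" 50) where
  "X \<cong>\<^sub>s Y \<longleftrightarrow> elems X = elems Y \<and>
     (\<exists>c>0. \<exists>C>0. \<forall>x\<in>elems X. c * nrm X x \<le> nrm Y x \<and> nrm Y x \<le> C * nrm X x)"

definition ell_inf :: seq_space where
  "ell_inf = \<lparr>elems = {x. bounded (range x)}, nrm = (\<lambda>x. SUP n. cmod (x n))\<rparr>"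

definition ell_1 :: seq_space where
  "ell_1 = \<lparr>elems = {x. summable (\<lambda>n. cmod (x n))}, nrm = (\<lambda>x. \<Sum>n. cmod (x n))\<rparr>"

definition sum_space :: "seq_space \<Rightarrow> seq_space \<Rightarrow> seq_space" where
  "sum_space X Y =
     \<lparr>elems = {(\<lambda>n. a n + b n) | a b. a \<in> elems X \<and> b \<in> elems Y},
      nrm = (\<lambda>x. Inf {nrm X a + nrm Y b | a b.
                        a \<in> elems X \<and> b \<in> elems Y \<and> x = (\<lambda>n. a n + b n)})\<rparr>"


subsection \<open>Vector-valued analytic functions\<close>

definition seq_tendsto ::
    "seq_space \<Rightarrow> ('a \<Rightarrow> nat \<Rightarrow> complex) \<Rightarrow> (nat \<Rightarrow> complex) \<Rightarrow> 'a filter \<Rightarrow> bool" where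
  "seq_tendsto X g l G \<longleftrightarrow> l \<in> elems X \<and> (\<forall>\<^sub>F w in G. g w \<in> elems X) \<and>
     ((\<lambda>w. nrm X (\<lambda>n. g w n - l n)) \<longlongrightarrow> 0) G"

definition seq_continuous_on ::
    "seq_space \<Rightarrow> 'a::topological_space set \<Rightarrow> ('a \<Rightarrow> nat \<Rightarrow> complex) \<Rightarrow> bool" where
  "seq_continuous_on X S g \<longleftrightarrow>
     (\<forall>z\<in>S. g z \<in> elems X \<and> seq_tendsto X g (g z) (at z within S))"

definition has_seq_deriv ::
    "seq_space \<Rightarrow> (complex \<Rightarrow> nat \<Rightarrow> complex) \<Rightarrow> (nat \<Rightarrow> complex) \<Rightarrow> complex \<Rightarrow> bool" where
  "has_seq_deriv X F d z \<longleftrightarrow> seq_tendsto X (\<lambda>w n. (F w n - F z n) / (w - z)) d (at z)"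

definition seq_deriv ::
    "seq_space \<Rightarrow> (complex \<Rightarrow> nat \<Rightarrow> complex) \<Rightarrow> complex \<Rightarrow> nat \<Rightarrow> complex" where
  "seq_deriv X F z = (THE d. has_seq_deriv X F d z)"

definition seq_analytic_on ::
    "seq_space \<Rightarrow> complex set \<Rightarrow> (complex \<Rightarrow> nat \<Rightarrow> complex) \<Rightarrow> bool" where
  "seq_analytic_on X S F \<longleftrightarrow> (\<forall>z\<in>S. \<exists>d. has_seq_deriv X F d z)"


subsection \<open>The Calderon space of a couple\<close>

definition strip :: "complex set" where
  "strip = {z. 0 \<le> Re z \<and> Re z \<le> 1}"

definition open_strip :: "complex set" where
  "open_strip = {z. 0 < Re z \<and> Re z < 1}"

definition boundary_condition ::
    "seq_space \<Rightarrow> real \<Rightarrow> (complex \<Rightarrow> nat \<Rightarrow> complex) \<Rightarrow> bool" where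
  "boundary_condition X j F \<longleftrightarrow>
     seq_continuous_on X UNIV (\<lambda>t. F (Complex j t)) \<and>
     seq_tendsto X (\<lambda>t. F (Complex j t)) (\<lambda>n. 0) at_infinity"

text \<open>
  Elements of the Calderon space are represented by total functions on \<open>complex\<close>. Their
  values outside the closed strip are irrelevant: neither the norm nor the derivatives at
  \<open>1/2\<close> depend on them.
\<close>

definition calderon :: "seq_space \<Rightarrow> seq_space \<Rightarrow> (complex \<Rightarrow> nat \<Rightarrow> complex) set" where
  "calderon X0 X1 =
     {F. seq_continuous_on (sum_space X0 X1) strip F \<and>
         (\<exists>B. \<forall>z\<in>strip. nrm (sum_space X0 X1) (F z) \<le> B) \<and>
         seq_analytic_on (sum_space X0 X1) open_strip F \<and>
         boundary_condition X0 0 F \<and> boundary_condition X1 1 F}"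

definition calderon_norm :: "seq_space \<Rightarrow> seq_space \<Rightarrow> (complex \<Rightarrow> nat \<Rightarrow> complex) \<Rightarrow> real" where
  "calderon_norm X0 X1 F =
     max (SUP t. nrm X0 (F (Complex 0 t))) (SUP t. nrm X1 (F (Complex 1 t)))"

definition Delta ::
    "seq_space \<Rightarrow> seq_space \<Rightarrow> nat \<Rightarrow> (complex \<Rightarrow> nat \<Rightarrow> complex) \<Rightarrow> nat \<Rightarrow> complex" where
  "Delta X0 X1 k F = (\<lambda>n. (seq_deriv (sum_space X0 X1) ^^ k) F (1/2) n / fact k)"

definition ker_Delta ::
    "seq_space \<Rightarrow> seq_space \<Rightarrow> nat \<Rightarrow> (complex \<Rightarrow> nat \<Rightarrow> complex) set" where
  "ker_Delta X0 X1 k = {F \<in> calderon X0 X1. Delta X0 X1 k F = (\<lambda>n. 0)}"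

text \<open>The space \<open>T(K)\<close> with its quotient norm, for \<open>K\<close> a subset of the Calderon space.\<close>

definition image_space ::
    "seq_space \<Rightarrow> seq_space \<Rightarrow> ((complex \<Rightarrow> nat \<Rightarrow> complex) \<Rightarrow> nat \<Rightarrow> complex) \<Rightarrow>
     (complex \<Rightarrow> nat \<Rightarrow> complex) set \<Rightarrow> seq_space" where
  "image_space X0 X1 T K =
     \<lparr>elems = T ` K, nrm = (\<lambda>x. Inf {calderon_norm X0 X1 F | F. F \<in> K \<and> T F = x})\<rparr>"


subsection \<open>Orlicz sequence spaces and duals\<close>

definition orlicz_function :: "(real \<Rightarrow> real) \<Rightarrow> bool" where
  "orlicz_function f \<longleftrightarrow> continuous_on {0..} f \<and> mono_on {0..} f \<and> convex_on {0..} f \<and>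
     f 0 = 0 \<and> filterlim f at_top at_top"

text \<open>The Orlicz sequence space of \<open>f\<close> with the Luxemburg norm.\<close>

definition orlicz_space :: "(real \<Rightarrow> real) \<Rightarrow> seq_space" where
  "orlicz_space f =
     \<lparr>elems = {x. \<exists>r>0. summable (\<lambda>n. f (cmod (x n) / r))},
      nrm = (\<lambda>x. Inf {r. r > 0 \<and> summable (\<lambda>n. f (cmod (x n) / r)) \<and>
                          (\<Sum>n. f (cmod (x n) / r)) \<le> 1})\<rparr>"

definition bounded_functional :: "seq_space \<Rightarrow> ((nat \<Rightarrow> complex) \<Rightarrow> complex) \<Rightarrow> bool" where
  "bounded_functional X \<phi> \<longleftrightarrow>
     (\<forall>x\<in>elems X. \<forall>y\<in>elems X. \<phi> (\<lambda>n. x n + y n) = \<phi> x + \<phi> y) \<and>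
     (\<forall>c. \<forall>x\<in>elems X. \<phi> (\<lambda>n. c * x n) = c * \<phi> x) \<and>
     (\<exists>B. \<forall>x\<in>elems X. cmod (\<phi> x) \<le> B * nrm X x)"

definition functional_norm :: "seq_space \<Rightarrow> ((nat \<Rightarrow> complex) \<Rightarrow> complex) \<Rightarrow> real" where
  "functional_norm X \<phi> = (SUP x\<in>{x\<in>elems X. nrm X x \<le> 1}. cmod (\<phi> x))"

text \<open>
  The dual of a sequence space as a sequence space: \<open>y\<close> stands for the bounded functional
  \<open>x \<mapsto> \<Sum>n. x n * y n\<close> (bilinear pairing, no complex conjugation).
\<close>

definition dual_space :: "seq_space \<Rightarrow> seq_space" where
  "dual_space X =
     \<lparr>elems = {y. \<exists>\<phi>. bounded_functional X \<phi> \<and> (\<forall>x\<in>elems X. (\<lambda>n. x n * y n) sums \<phi> x)},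
      nrm = (\<lambda>y. functional_norm X (\<lambda>x. \<Sum>n. x n * y n))\<rparr>"

end

theory Submission
  imports Defs "HOL-Complex_Analysis.Complex_Analysis"
begin

text \<open>
  All three spaces coincide with the Orlicz space of \<open>g t = (t / (1 + log\<^sup>+ (1 / t)))\<^sup>2\<close>, which is
  equivalent near \<open>0\<close> to the Young conjugate of \<open>t\<^sup>2 log\<^sup>2 t\<close>.

  Let \<open>F\<close> be in the Calderon space with norm at most \<open>1\<close>, and let \<open>m\<^sub>n\<close> be a weighted mean of
  \<open>|F\<^sub>n|\<close> over the line \<open>Re z = 1\<close>, so that \<open>\<Sum>n. m\<^sub>n\<close> is bounded. Cauchy's formula on a
  long rectangle bounds the Taylor coefficients at \<open>1/2\<close> of \<open>F\<^sub>n m\<^sub>n\<^bsup>-z\<^esup>\<close> by a constant. If the value or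
  the first derivative of \<open>F\<^sub>n\<close> at \<open>1/2\<close> vanishes, the term with \<open>(ln m\<^sub>n)\<^sup>2\<close> disappears from the
  second derivative, which is therefore at most a constant times \<open>m\<^sub>n\<^bsup>1/2\<^esup> (1 + |ln m\<^sub>n|)\<close>; and \<open>g\<close>
  of this quantity is at most a constant times \<open>m\<^sub>n\<close>. Conversely, functions
  \<open>exp ((z - 1/2)\<^sup>2 + L\<^sub>n z) (a\<^sub>n + b\<^sub>n (z - 1/2))\<close> realise every element of the Orlicz space
  of \<open>g\<close>. The identification of the dual is the usual argument with Young's inequality.
\<close>

subsection \<open>Sequence spaces and families of holomorphic functions\<close>

text \<open>The function \<open>g\<close> comes from maximising \<open>s * t - f s\<close>: up to
  constants the maximum is reached at \<open>s = t / (ln t)^2\<close> and has size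
  \<open>(t / ln t)^2\<close>. On the side of the couple, \<open>m^z\<close> has modulus 1 on the
  left line and \<open>m\<close> on the right one, and equals \<open>sqrt m\<close> at
  \<open>1/2\<close>. For small \<open>m\<close> the logarithm of \<open>sqrt m * |ln m|\<close> is
  comparable to \<open>ln m\<close>, so inverting \<open>t = sqrt m * |ln m|\<close> gives
  \<open>m\<close> of order \<open>(t / ln t)^2\<close>, the same \<open>g\<close>.

  Two obstacles shape the details. A mean of \<open>|F_n|\<close> may be 0, and no single rectangle
  makes its horizontal sides negligible for all \<open>n\<close> at once. The upper estimate
  therefore treats \<open>N\<close> coordinates at a time, adds \<open>1 / N\<close> to each mean
  and lets the rectangle depend on \<open>N\<close>; the final constants do not. In the converse
  direction, membership in the Calderon space demands continuity into \<open>ell_inf\<close>, that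
  is, uniformly in the coordinates, and bounded coefficients alone do not give it.\<close>

lemma elems_ell_inf: "x \<in> elems ell_inf \<longleftrightarrow> (\<exists>B. \<forall>n. cmod (x n) \<le> B)"
  by (auto simp: ell_inf_def bounded_iff)

lemma cmod_le_nrm_ell_inf:
  assumes "x \<in> elems ell_inf"
  shows "cmod (x n) \<le> nrm ell_inf x"
proof -
  obtain B where "\<And>n. cmod (x n) \<le> B" using assms by (auto simp: elems_ell_inf)
  then have "bdd_above (range (\<lambda>n. cmod (x n)))" by (auto intro!: bdd_aboveI[of _ B])
  then show ?thesis by (auto simp: ell_inf_def intro: cSUP_upper2)
qed

lemma nrm_ell_inf_le:
  assumes "\<And>n. cmod (x n) \<le> B"
  shows "nrm ell_inf x \<le> B"
  using assms by (auto simp: ell_inf_def intro!: cSUP_least)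

lemma nrm_ell_inf_nonneg: "x \<in> elems ell_inf \<Longrightarrow> 0 \<le> nrm ell_inf x"
  using cmod_le_nrm_ell_inf[of x 0] norm_ge_zero[of "x 0"] by linarith

lemma elems_ell_inf_diff:
  assumes "x \<in> elems ell_inf" "y \<in> elems ell_inf"
  shows "(\<lambda>n. x n - y n) \<in> elems ell_inf"
proof -
  obtain B C where "\<And>n. cmod (x n) \<le> B" "\<And>n. cmod (y n) \<le> C"
    using assms by (auto simp: elems_ell_inf)
  then have "cmod (x n - y n) \<le> B + C" for n
    by (rule order_trans[OF norm_triangle_ineq4 add_mono])
  then show ?thesis by (auto simp: elems_ell_inf)
qed

lemma elems_ell_1: "x \<in> elems ell_1 \<longleftrightarrow> summable (\<lambda>n. cmod (x n))"
  by (simp add: ell_1_def)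

lemma nrm_ell_1: "nrm ell_1 x = (\<Sum>n. cmod (x n))"
  by (simp add: ell_1_def)

lemma cmod_le_nrm_ell_1:
  assumes "x \<in> elems ell_1"
  shows "cmod (x n) \<le> nrm ell_1 x"
proof -
  have "sum (\<lambda>n. cmod (x n)) {n} \<le> (\<Sum>n. cmod (x n))"
    using assms unfolding elems_ell_1 by (intro sum_le_suminf) auto
  then show ?thesis by (simp add: nrm_ell_1)
qed

lemma nrm_ell_1_nonneg: "x \<in> elems ell_1 \<Longrightarrow> 0 \<le> nrm ell_1 x"
  by (simp add: nrm_ell_1 elems_ell_1 suminf_nonneg)

lemma elems_ell_1_diff:
  assumes "x \<in> elems ell_1" "y \<in> elems ell_1"
  shows "(\<lambda>n. x n - y n) \<in> elems ell_1"
  unfolding elems_ell_1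
proof (rule summable_comparison_test')
  show "summable (\<lambda>n. cmod (x n) + cmod (y n))"
    using assms by (simp add: elems_ell_1 summable_add)
qed (simp add: norm_triangle_ineq4)

lemma nrm_ell_1_le_add_diff:
  assumes "x \<in> elems ell_1" "y \<in> elems ell_1"
  shows "nrm ell_1 x \<le> nrm ell_1 y + nrm ell_1 (\<lambda>n. x n - y n)"
proof -
  note s = assms[unfolded elems_ell_1] elems_ell_1_diff[OF assms, unfolded elems_ell_1]
  have "cmod (x n) \<le> cmod (y n) + cmod (x n - y n)" for n
    using norm_triangle_ineq[of "y n" "x n - y n"] by simp
  then have "(\<Sum>n. cmod (x n)) \<le> (\<Sum>n. cmod (y n) + cmod (x n - y n))"
    using s by (intro suminf_le summable_add) auto
  also have "\<dots> = nrm ell_1 y + nrm ell_1 (\<lambda>n. x n - y n)"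
    using s by (simp add: nrm_ell_1 suminf_add)
  finally show ?thesis by (simp add: nrm_ell_1)
qed

lemma elems_sum_space_ell_inf_ell_1: "elems (sum_space ell_inf ell_1) = elems ell_inf"
proof (intro set_eqI iffI)
  fix x assume "x \<in> elems (sum_space ell_inf ell_1)"
  then obtain a b where x: "x = (\<lambda>n. a n + b n)" "a \<in> elems ell_inf" "b \<in> elems ell_1"
    by (auto simp: sum_space_def)
  have "cmod (x n) \<le> nrm ell_inf a + nrm ell_1 b" for n
    using norm_triangle_ineq[of "a n" "b n"] cmod_le_nrm_ell_inf[OF x(2), of n]
      cmod_le_nrm_ell_1[OF x(3), of n] by (simp add: x(1))
  then show "x \<in> elems ell_inf" by (auto simp: elems_ell_inf)
next
  fix x assume "x \<in> elems ell_inf"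
  then have "x \<in> {(\<lambda>n. a n + b n) | a b. a \<in> elems ell_inf \<and> b \<in> elems ell_1}"
    by (intro CollectI exI[of _ x] exI[of _ "\<lambda>n. 0"]) (simp add: elems_ell_1)
  then show "x \<in> elems (sum_space ell_inf ell_1)" by (simp add: sum_space_def)
qed

text \<open>The splitting \<open>x + 0\<close> is optimal because the sup norm of the second part is
  at most its \<open>ell_1\<close> norm. So the sum space is \<open>ell_inf\<close> isometrically,
  and vector-valued statements become scalar ones that are uniform in the coordinate.\<close>

lemma nrm_sum_space_ell_inf_ell_1:
  assumes "x \<in> elems ell_inf"
  shows "nrm (sum_space ell_inf ell_1) x = nrm ell_inf x"
proof -
  let ?S = "{nrm ell_inf a + nrm ell_1 b | a b.
               a \<in> elems ell_inf \<and> b \<in> elems ell_1 \<and> x = (\<lambda>n. a n + b n)}"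
  have "Inf ?S = nrm ell_inf x"
  proof (rule cInf_eq_minimum)
    have "nrm ell_inf x = nrm ell_inf x + nrm ell_1 (\<lambda>n. 0)" "x = (\<lambda>n. x n + 0)"
      "(\<lambda>n. 0) \<in> elems ell_1"
      by (auto simp: elems_ell_1 nrm_ell_1)
    with assms show "nrm ell_inf x \<in> ?S" by blast
  next
    fix s assume "s \<in> ?S"
    then obtain a b where s: "s = nrm ell_inf a + nrm ell_1 b" "x = (\<lambda>n. a n + b n)"
      "a \<in> elems ell_inf" "b \<in> elems ell_1" by auto
    have "cmod (x n) \<le> s" for n
      using norm_triangle_ineq[of "a n" "b n"] cmod_le_nrm_ell_inf[OF s(3), of n]
        cmod_le_nrm_ell_1[OF s(4), of n] by (simp add: s)
    then show "nrm ell_inf x \<le> s" by (rule nrm_ell_inf_le)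
  qed
  then show ?thesis by (simp add: sum_space_def)
qed

section \<open>Limits, continuity and derivatives in the sum space\<close>

lemma seq_tendsto_sum_space_iff:
  "seq_tendsto (sum_space ell_inf ell_1) g l G \<longleftrightarrow> seq_tendsto ell_inf g l G"
proof -
  have "((\<lambda>w. nrm (sum_space ell_inf ell_1) (\<lambda>n. g w n - l n)) \<longlongrightarrow> 0) G \<longleftrightarrow>
        ((\<lambda>w. nrm ell_inf (\<lambda>n. g w n - l n)) \<longlongrightarrow> 0) G"
    if "l \<in> elems ell_inf" "\<forall>\<^sub>F w in G. g w \<in> elems ell_inf"
    by (rule tendsto_cong, rule eventually_mono[OF that(2)])
      (use that(1) in \<open>simp add: nrm_sum_space_ell_inf_ell_1 elems_ell_inf_diff\<close>)
  then show ?thesis unfolding seq_tendsto_def elems_sum_space_ell_inf_ell_1 by blast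
qed

lemma seq_tendsto_ell_infD:
  assumes "seq_tendsto ell_inf g l G"
  shows "((\<lambda>w. g w n) \<longlongrightarrow> l n) G"
proof -
  have "((\<lambda>w. g w n - l n) \<longlongrightarrow> 0) G"
  proof (rule Lim_null_comparison)
    show "\<forall>\<^sub>F w in G. cmod (g w n - l n) \<le> nrm ell_inf (\<lambda>n. g w n - l n)"
      using assms unfolding seq_tendsto_def
      by (auto elim!: eventually_mono intro: cmod_le_nrm_ell_inf[OF elems_ell_inf_diff])
  qed (use assms in \<open>simp add: seq_tendsto_def\<close>)
  then show ?thesis by (simp add: LIM_zero_iff)
qed

lemma seq_tendsto_ell_infI:
  assumes "l \<in> elems ell_inf" "\<forall>\<^sub>F w in G. g w \<in> elems ell_inf"
    and "\<And>e. e > 0 \<Longrightarrow> \<forall>\<^sub>F w in G. \<forall>n. cmod (g w n - l n) \<le> e"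
  shows "seq_tendsto ell_inf g l G"
  unfolding seq_tendsto_def
proof (intro conjI assms(1,2) tendstoI)
  fix e :: real assume "e > 0"
  then have "\<forall>\<^sub>F w in G. \<forall>n. cmod (g w n - l n) \<le> e / 2" by (intro assms(3)) auto
  then show "\<forall>\<^sub>F w in G. dist (nrm ell_inf (\<lambda>n. g w n - l n)) 0 < e"
    using assms(2)
  proof eventually_elim
    case (elim w)
    then have "nrm ell_inf (\<lambda>n. g w n - l n) \<le> e / 2" by (intro nrm_ell_inf_le) auto
    moreover have "0 \<le> nrm ell_inf (\<lambda>n. g w n - l n)"
      using elim assms(1) by (intro nrm_ell_inf_nonneg elems_ell_inf_diff)
    ultimately show ?case using \<open>e > 0\<close> by simp
  qed
qed

lemma seq_continuous_on_sum_space_iff: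
  "seq_continuous_on (sum_space ell_inf ell_1) S g \<longleftrightarrow> seq_continuous_on ell_inf S g"
  by (simp add: seq_continuous_on_def seq_tendsto_sum_space_iff elems_sum_space_ell_inf_ell_1)

lemma has_seq_deriv_sum_space_iff:
  "has_seq_deriv (sum_space ell_inf ell_1) F d z \<longleftrightarrow> has_seq_deriv ell_inf F d z"
  by (simp add: has_seq_deriv_def seq_tendsto_sum_space_iff)

lemma has_seq_deriv_ell_infD:
  assumes "has_seq_deriv ell_inf F d z"
  shows "((\<lambda>w. F w n) has_field_derivative d n) (at z)"
  using seq_tendsto_ell_infD[OF assms[unfolded has_seq_deriv_def], of n]
  by (simp add: has_field_derivative_iff)

lemma seq_deriv_sum_space_eqI:
  assumes "has_seq_deriv ell_inf F d z"
  shows "seq_deriv (sum_space ell_inf ell_1) F z = d"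
  unfolding seq_deriv_def has_seq_deriv_sum_space_iff
proof (rule the_equality)
  fix d' assume "has_seq_deriv ell_inf F d' z"
  then show "d' = d"
    using has_seq_deriv_ell_infD[OF assms] has_seq_deriv_ell_infD
    by (blast intro: DERIV_unique ext)
qed fact

text \<open>A scalar form of analyticity into \<open>ell_inf\<close>. The bounds are uniform in
  \<open>n\<close> but only local in \<open>z\<close>, because a bound on all of \<open>S\<close>
  would not pass to the derivative, and closure under differentiation is what iterating
  \<open>seq_deriv\<close> requires.\<close>

definition bounded_holomorphic_family :: "complex set \<Rightarrow> (complex \<Rightarrow> nat \<Rightarrow> complex) \<Rightarrow> bool" where
  "bounded_holomorphic_family S F \<longleftrightarrow> (\<forall>n. (\<lambda>w. F w n) holomorphic_on S) \<and>
     (\<forall>z\<in>S. \<exists>r>0. \<exists>B. cball z r \<subseteq> S \<and> (\<forall>w\<in>cball z r. \<forall>n. cmod (F w n) \<le> B))"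

lemma bounded_holomorphic_family_cauchy:
  assumes "bounded_holomorphic_family S F" "z \<in> S"
  obtains r B where "r > 0" "cball z r \<subseteq> S"
    "\<And>w n. w \<in> cball z r \<Longrightarrow> cmod (F w n) \<le> B"
    "\<And>w n. w \<in> cball z r \<Longrightarrow> cmod (deriv (\<lambda>w. F w n) w) \<le> B"
    "\<And>w n. w \<in> cball z r \<Longrightarrow> cmod ((deriv ^^ 2) (\<lambda>w. F w n) w) \<le> B"
proof -
  obtain r B where r: "r > 0" "cball z r \<subseteq> S" and B: "\<forall>w\<in>cball z r. \<forall>n. cmod (F w n) \<le> B"
    and hol: "\<And>n. (\<lambda>w. F w n) holomorphic_on S"
    using assms by (auto simp: bounded_holomorphic_family_def)
  have D: "cmod ((deriv ^^ k) (\<lambda>w. F w n) w) \<le> fact k * B / (r / 2) ^ k"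
    if "w \<in> cball z (r / 2)" for w n k
  proof (rule Cauchy_inequality)
    have sub: "cball w (r / 2) \<subseteq> cball z r"
    proof
      fix u assume "u \<in> cball w (r / 2)"
      then show "u \<in> cball z r" using that dist_triangle[of z u w] by simp
    qed
    have "(\<lambda>w. F w n) holomorphic_on cball w (r / 2)"
      using hol sub r(2) by (blast intro: holomorphic_on_subset)
    then show "(\<lambda>w. F w n) holomorphic_on ball w (r / 2)" "continuous_on (cball w (r / 2)) (\<lambda>w. F w n)"
      by (auto intro: holomorphic_on_subset holomorphic_on_imp_continuous_on)
    show "cmod (F x n) \<le> B" if "cmod (w - x) = r / 2" for x
      using B sub that by (auto simp: dist_norm)
  qed (use r in auto)
  define C where "C = max B (max (B / (r / 2)) (2 * B / (r / 2) ^ 2))"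
  show thesis
  proof (rule that[of "r / 2" C])
    show "cmod (F w n) \<le> C" if "w \<in> cball z (r / 2)" for w n
      using D[OF that, of 0 n] by (simp add: C_def le_max_iff_disj)
    show "cmod (deriv (\<lambda>w. F w n) w) \<le> C" if "w \<in> cball z (r / 2)" for w n
      using D[OF that, of 1 n] by (simp add: C_def le_max_iff_disj)
    show "cmod ((deriv ^^ 2) (\<lambda>w. F w n) w) \<le> C" if "w \<in> cball z (r / 2)" for w n
      using D[OF that, of 2 n] by (simp add: C_def le_max_iff_disj)
    show "cball z (r / 2) \<subseteq> S" using r by (auto intro!: order_trans[OF subset_cball r(2)])
  qed (use r in auto)
qed

text \<open>Taylor's formula of first order has a remainder controlled by the second derivative,
  which is bounded uniformly in \<open>n\<close>. The difference quotients therefore converge at the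
  rate \<open>B * cmod (w - z)\<close> in all coordinates simultaneously.\<close>

lemma bounded_holomorphic_family_has_seq_deriv:
  assumes "bounded_holomorphic_family S F" "open S" "z \<in> S"
  shows "has_seq_deriv ell_inf F (\<lambda>n. deriv (\<lambda>w. F w n) z) z"
proof -
  obtain r B where r: "r > 0" "cball z r \<subseteq> S"
    and B: "\<And>w n. w \<in> cball z r \<Longrightarrow> cmod (F w n) \<le> B"
    "\<And>w n. w \<in> cball z r \<Longrightarrow> cmod (deriv (\<lambda>w. F w n) w) \<le> B"
    "\<And>w n. w \<in> cball z r \<Longrightarrow> cmod ((deriv ^^ 2) (\<lambda>w. F w n) w) \<le> B"
    using bounded_holomorphic_family_cauchy[OF assms(1,3)] by metis
  have hol: "(\<lambda>w. F w n) holomorphic_on S" for n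
    using assms(1) by (simp add: bounded_holomorphic_family_def)
  have B0: "B \<ge> 0" using order_trans[OF norm_ge_zero B(1)[of z 0]] r(1) by simp
  have est: "cmod ((F w n - F z n) / (w - z) - deriv (\<lambda>w. F w n) z) \<le> B * cmod (w - z)"
    if w: "w \<in> cball z r" "w \<noteq> z" for w n
  proof -
    have "cmod ((deriv ^^ 0) (\<lambda>w. F w n) w - (\<Sum>i\<le>1. (deriv ^^ i) (\<lambda>w. F w n) z * (w - z) ^ i / fact i))
            \<le> B * cmod (w - z) ^ Suc 1 / fact 1"
    proof (rule complex_Taylor[where S = "cball z r" and f = "\<lambda>i. (deriv ^^ i) (\<lambda>w. F w n)"])
      fix i x assume x: "x \<in> cball z r"
      then have "((deriv ^^ i) (\<lambda>w. F w n) has_field_derivative (deriv ^^ Suc i) (\<lambda>w. F w n) x) (at x)"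
        using holomorphic_derivI[OF holomorphic_higher_deriv[OF hol assms(2)] assms(2)] r(2)
        by auto
      then show "((deriv ^^ i) (\<lambda>w. F w n) has_field_derivative (deriv ^^ Suc i) (\<lambda>w. F w n) x)
                   (at x within cball z r)"
        by (rule has_field_derivative_at_within)
    next
      fix x assume "x \<in> cball z r"
      then show "cmod ((deriv ^^ Suc 1) (\<lambda>w. F w n) x) \<le> B"
        using B(3) by (simp add: numeral_2_eq_2)
    qed (use w r in auto)
    then have "cmod (F w n - F z n - deriv (\<lambda>w. F w n) z * (w - z)) \<le> B * cmod (w - z) * cmod (w - z)"
      by (simp add: power2_eq_square algebra_simps)
    moreover have "F w n - F z n - deriv (\<lambda>w. F w n) z * (w - z)
        = ((F w n - F z n) / (w - z) - deriv (\<lambda>w. F w n) z) * (w - z)"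
      using w by (simp add: field_simps)
    ultimately show ?thesis using w by (simp add: norm_mult)
  qed
  have ev: "\<forall>\<^sub>F w in at z. w \<in> cball z r \<and> w \<noteq> z"
    using r(1) by (auto simp: eventually_at dist_commute intro!: exI[of _ r])
  show ?thesis unfolding has_seq_deriv_def
  proof (rule seq_tendsto_ell_infI)
    show "(\<lambda>n. deriv (\<lambda>w. F w n) z) \<in> elems ell_inf"
      using B(2)[of z] r by (auto simp: elems_ell_inf intro!: exI[of _ B])
    show "\<forall>\<^sub>F w in at z. (\<lambda>n. (F w n - F z n) / (w - z)) \<in> elems ell_inf"
      using ev
    proof eventually_elim
      case (elim w)
      have "cmod ((F w n - F z n) / (w - z)) \<le> B * cmod (w - z) + B" for n
        using norm_triangle_sub[of "(F w n - F z n) / (w - z)" "deriv (\<lambda>w. F w n) z"]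
          est[of w n] B(2)[of z n] elim r(1) by (simp del: times_divide_eq_right)
      then show ?case unfolding elems_ell_inf by blast
    qed
  next
    fix e :: real assume "e > 0"
    then have "\<forall>\<^sub>F w in at z. w \<in> ball z (e / (B + 1))"
      using B0 by (intro eventually_at_in_open') auto
    with ev show "\<forall>\<^sub>F w in at z. \<forall>n. cmod ((F w n - F z n) / (w - z) - deriv (\<lambda>w. F w n) z) \<le> e"
    proof eventually_elim
      case (elim w)
      have "B * cmod (w - z) \<le> (B + 1) * cmod (w - z)" by (simp add: mult_right_mono)
      also have "\<dots> \<le> e" using elim B0 by (auto simp: dist_norm norm_minus_commute field_simps)
      finally show ?case using est elim by (meson order_trans)
    qed
  qed
qed

lemma bounded_holomorphic_family_seq_deriv:
  assumes F: "bounded_holomorphic_family S F" and S: "open S"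
  shows "bounded_holomorphic_family S (seq_deriv (sum_space ell_inf ell_1) F)"
    and "z \<in> S \<Longrightarrow> seq_deriv (sum_space ell_inf ell_1) F z n = deriv (\<lambda>w. F w n) z"
proof -
  have eq: "seq_deriv (sum_space ell_inf ell_1) F z = (\<lambda>n. deriv (\<lambda>w. F w n) z)" if "z \<in> S" for z
    using bounded_holomorphic_family_has_seq_deriv[OF F S that] by (rule seq_deriv_sum_space_eqI)
  then show "z \<in> S \<Longrightarrow> seq_deriv (sum_space ell_inf ell_1) F z n = deriv (\<lambda>w. F w n) z" by simp
  show "bounded_holomorphic_family S (seq_deriv (sum_space ell_inf ell_1) F)"
    unfolding bounded_holomorphic_family_def
  proof (intro conjI allI ballI)
    fix n
    have "deriv (\<lambda>w. F w n) holomorphic_on S"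
      using F S by (auto simp: bounded_holomorphic_family_def intro: holomorphic_deriv)
    then show "(\<lambda>w. seq_deriv (sum_space ell_inf ell_1) F w n) holomorphic_on S"
      by (rule holomorphic_transform) (simp add: eq)
  next
    fix z assume "z \<in> S"
    from bounded_holomorphic_family_cauchy[OF F this] obtain r B where
      "r > 0" "cball z r \<subseteq> S" "\<And>w n. w \<in> cball z r \<Longrightarrow> cmod (deriv (\<lambda>w. F w n) w) \<le> B"
      by metis
    then have "cball z r \<subseteq> S \<and>
        (\<forall>w\<in>cball z r. \<forall>n. cmod (seq_deriv (sum_space ell_inf ell_1) F w n) \<le> B)"
      by (simp add: eq subset_iff del: mem_cball)
    with \<open>r > 0\<close> show "\<exists>r>0. \<exists>B. cball z r \<subseteq> S \<and>
        (\<forall>w\<in>cball z r. \<forall>n. cmod (seq_deriv (sum_space ell_inf ell_1) F w n) \<le> B)"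
      by blast
  qed
qed

lemma funpow_seq_deriv:
  assumes "bounded_holomorphic_family S F" "open S" "z \<in> S"
  shows "(seq_deriv (sum_space ell_inf ell_1) ^^ k) F z n = (deriv ^^ k) (\<lambda>w. F w n) z"
  using assms
proof (induction k arbitrary: F)
  case (Suc k)
  let ?G = "seq_deriv (sum_space ell_inf ell_1) F"
  \<comment> \<open>\<open>seq_deriv\<close> and \<open>deriv\<close> are known to agree on
    \<open>S\<close> only. Since \<open>S\<close> is open this is agreement near \<open>z\<close>,
    which determines all higher derivatives at \<open>z\<close>.\<close>
  have "(deriv ^^ k) (\<lambda>w. ?G w n) z = (deriv ^^ k) (deriv (\<lambda>w. F w n)) z"
    using Suc.prems bounded_holomorphic_family_seq_deriv(2)
    by (intro higher_deriv_cong_ev eventually_mono[OF eventually_nhds_in_open[of S]]) auto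
  then show ?case
    using Suc.IH[OF bounded_holomorphic_family_seq_deriv(1)] Suc.prems
    by (simp add: funpow_Suc_right del: funpow.simps)
qed simp

lemma open_open_strip: "open open_strip"
proof -
  have "open_strip = {z. Re z > 0} \<inter> {z. Re z < 1}" by (auto simp: open_strip_def)
  then show ?thesis by (metis open_halfspace_Re_gt open_halfspace_Re_lt open_Int)
qed

lemma Delta_eq:
  assumes "bounded_holomorphic_family open_strip F"
  shows "Delta ell_inf ell_1 k F n = (deriv ^^ k) (\<lambda>w. F w n) (1/2) / fact k"
  using funpow_seq_deriv[OF assms open_open_strip, of "1/2"]
  by (simp add: Delta_def open_strip_def)

lemma bounded_holomorphic_familyI:
  assumes "open S" "\<And>n. (\<lambda>w. F w n) holomorphic_on S"
    and "\<And>w n. w \<in> S \<Longrightarrow> cmod (F w n) \<le> B"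
  shows "bounded_holomorphic_family S F"
  unfolding bounded_holomorphic_family_def
proof (intro conjI allI ballI assms(2))
  fix z assume "z \<in> S"
  then obtain r where "r > 0" "cball z r \<subseteq> S"
    using assms(1) open_contains_cball by blast
  then show "\<exists>r>0. \<exists>B. cball z r \<subseteq> S \<and> (\<forall>w\<in>cball z r. \<forall>n. cmod (F w n) \<le> B)"
    using assms(3) by (blast intro: subsetD)
qed

text \<open>The Gaussian supplies decay along the strip, both for Cauchy's formula on long
  rectangles and for the functions of the converse direction. It is weakened to the density
  \<open>1 / (1 + t^2)\<close>, whose integral is an explicit arctangent.\<close>

lemma norm_exp_centered_square_le:
  assumes "u \<in> strip"
  shows "cmod (exp ((u - 1/2)\<^sup>2)) \<le> 2 / (1 + (Im u)\<^sup>2)"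
proof -
  have "Re ((u - 1/2)\<^sup>2) = (Re u - 1/2)\<^sup>2 - (Im u)\<^sup>2"
    by (simp add: power2_eq_square)
  also have "\<dots> \<le> 1/4 - (Im u)\<^sup>2"
  proof -
    have "\<bar>Re u - 1/2\<bar> \<le> 1/2" using assms unfolding strip_def abs_le_iff by auto
    then have "(Re u - 1/2)\<^sup>2 \<le> (1/2)\<^sup>2" by (simp only: power2_le_iff_abs_le)
    then show ?thesis by (simp add: power2_eq_square)
  qed
  finally have "cmod (exp ((u - 1/2)\<^sup>2)) \<le> exp (1/4) * exp (- (Im u)\<^sup>2)"
    by (simp add: exp_add[symmetric])
  also have "\<dots> \<le> 2 * (1 / (1 + (Im u)\<^sup>2))"
  proof (rule mult_mono)
    have "exp (1/4 :: real) \<le> 1 + 1/4 + (1/4)\<^sup>2" by (rule exp_bound) auto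
    then show "exp (1/4 :: real) \<le> 2" by (simp add: power2_eq_square)
    have "1 + (Im u)\<^sup>2 \<le> exp ((Im u)\<^sup>2)" by (rule exp_ge_add_one_self)
    then show "exp (- (Im u)\<^sup>2) \<le> 1 / (1 + (Im u)\<^sup>2)"
      by (simp add: exp_minus field_simps add_pos_nonneg)
  qed auto
  finally show ?thesis by simp
qed

subsection \<open>The conjugate Orlicz function\<close>

text \<open>Since \<open>ln 0 = 0\<close>, the weight at \<open>0\<close> is \<open>1\<close>.\<close>

definition log_weight :: "real \<Rightarrow> real" where
  "log_weight t = 1 + max 0 (- ln t)"

text \<open>Not convex: the slope drops from 4 to 2 at \<open>t = 1\<close>. Its Orlicz space serves
  as an intermediate model, handled through monotonicity and
  \<open>dual_orlicz_divide_le\<close>.\<close>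

definition dual_orlicz :: "real \<Rightarrow> real" where
  "dual_orlicz t = (t / log_weight t)\<^sup>2"

lemma log_weight_ge_1: "1 \<le> log_weight t"
  by (simp add: log_weight_def)

lemma log_weight_pos: "0 < log_weight t"
  using log_weight_ge_1[of t] by linarith

lemma log_weight_antimono: "0 < s \<Longrightarrow> s \<le> t \<Longrightarrow> log_weight t \<le> log_weight s"
  using ln_mono[of s t] by (auto simp: log_weight_def max_def)

lemma log_weight_le_1: "0 < t \<Longrightarrow> t \<le> 1 \<Longrightarrow> log_weight t = 1 - ln t"
  by (simp add: log_weight_def)

lemma dual_orlicz_nonneg: "0 \<le> dual_orlicz t"
  by (simp add: dual_orlicz_def)

lemma dual_orlicz_0 [simp]: "dual_orlicz 0 = 0"
  by (simp add: dual_orlicz_def)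

lemma dual_orlicz_mono:
  assumes "0 \<le> s" "s \<le> t"
  shows "dual_orlicz s \<le> dual_orlicz t"
proof (cases "s = 0")
  case False
  with assms show ?thesis
    unfolding dual_orlicz_def
    by (intro power_mono frac_le log_weight_antimono log_weight_pos) (auto simp: less_imp_le[OF log_weight_pos])
qed (simp add: dual_orlicz_nonneg)

text \<open>Replaces convexity. A smaller argument has a larger logarithmic weight, so the quotient
  inside the square shrinks by at least the factor \<open>c\<close>, and \<open>c^2\<close> is at
  least \<open>c\<close>.\<close>

lemma dual_orlicz_divide_le:
  assumes "0 \<le> t" "1 \<le> c"
  shows "dual_orlicz (t / c) \<le> dual_orlicz t / c"
proof (cases "t = 0")
  case False
  have "t / c \<le> t" using assms by (simp add: divide_le_eq mult_le_cancel_left1)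
  then have "log_weight t \<le> log_weight (t / c)"
    using assms False by (intro log_weight_antimono) auto
  then have "t / log_weight (t / c) \<le> t / log_weight t"
    using assms by (intro divide_left_mono mult_pos_pos log_weight_pos)
  then have "(t / log_weight (t / c))\<^sup>2 \<le> dual_orlicz t"
    unfolding dual_orlicz_def using assms by (intro power_mono divide_nonneg_pos log_weight_pos)
  then have "(t / log_weight (t / c))\<^sup>2 / c\<^sup>2 \<le> dual_orlicz t / c"
    using assms dual_orlicz_nonneg[of t]
    by (intro frac_le) (auto simp: power2_eq_square)
  then show ?thesis by (simp add: dual_orlicz_def power_divide power_mult_distrib mult.commute)
qed simp

lemma dual_orlicz_le_1_imp:
  assumes "0 \<le> t" "dual_orlicz t \<le> 1"
  shows "t \<le> 1"
proof (rule ccontr)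
  assume "\<not> t \<le> 1"
  then have "dual_orlicz t = t\<^sup>2" by (simp add: dual_orlicz_def log_weight_def)
  with assms \<open>\<not> t \<le> 1\<close> show False by (simp add: power_le_one_iff abs_square_le_1)
qed

text \<open>With \<open>l = 1 - ln m\<close>, minus the logarithm of \<open>sqrt m * l\<close> is
  \<open>(l - 1) / 2 - ln l\<close>. The bound \<open>ln l \<le> l / 4 + 1 / 2\<close> takes away
  only half of the leading term, so the weight is at least \<open>l / 4\<close>; it cancels the
  factor \<open>l\<close>, and squaring the remaining \<open>4 * sqrt m\<close> gives the constant
  16.\<close>

lemma dual_orlicz_sqrt_log_le:
  assumes "0 < m" "m \<le> 1"
  shows "dual_orlicz (sqrt m * (1 - ln m)) \<le> 16 * m"
proof -
  define l where "l = 1 - ln m"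
  have l: "l \<ge> 1" using assms by (simp add: l_def)
  have "ln (l / 4) \<le> l / 4 - 1" using l by (intro ln_le_minus_one) simp
  moreover have "ln (4::real) \<le> 3 / 2"
  proof -
    have "ln (4::real) = 2 * ln 2" using ln_realpow[of 2 2] by simp
    then show ?thesis using ln_2_less_1 ln2_le_25_over_36 by linarith
  qed
  ultimately have "ln l \<le> l / 4 + 1 / 2" using l by (simp add: ln_div)
  moreover have "ln (sqrt m * l) = (1 - l) / 2 + ln l"
    using assms l ln_le_zero_iff[of m] by (subst ln_mult) (auto simp: ln_sqrt l_def simp del: ln_le_zero_iff)
  ultimately have "l / 4 \<le> log_weight (sqrt m * l)"
    unfolding log_weight_def using max.cobounded2[of "- ln (sqrt m * l)" 0] by (simp add: field_simps)
  then have "sqrt m * l / log_weight (sqrt m * l) \<le> sqrt m * l / (l / 4)"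
    using assms l by (intro divide_left_mono mult_pos_pos log_weight_pos) auto
  also have "\<dots> = 4 * sqrt m" using l by simp
  finally have "dual_orlicz (sqrt m * l) \<le> (4 * sqrt m)\<^sup>2"
    unfolding dual_orlicz_def using assms l
    by (intro power_mono divide_nonneg_pos log_weight_pos) auto
  then show ?thesis using assms by (simp add: l_def power_mult_distrib)
qed

section \<open>Equivalence of a sequence space with the Orlicz space of
  \<open>dual_orlicz\<close>\<close>

abbreviation in_unit_ball :: "(nat \<Rightarrow> complex) \<Rightarrow> bool" where
  "in_unit_ball v \<equiv> summable (\<lambda>n. dual_orlicz (cmod (v n))) \<and> (\<Sum>n. dual_orlicz (cmod (v n))) \<le> 1"

text \<open>Converts a bound on the modular into a bound on the norm. Finite partial sums suffice,
  which fits estimates whose proofs handle finitely many coordinates at a time.\<close>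

lemma in_unit_ballI:
  assumes "C \<ge> 1" "\<And>N. (\<Sum>n<N. dual_orlicz (cmod (v n))) \<le> C" "r \<ge> C"
  shows "in_unit_ball (\<lambda>n. v n / of_real r)"
proof -
  have le: "(\<Sum>n<N. dual_orlicz (cmod (v n / of_real r))) \<le> 1" for N
  proof -
    have "(\<Sum>n<N. dual_orlicz (cmod (v n / of_real r))) \<le> (\<Sum>n<N. dual_orlicz (cmod (v n)) / r)"
      using assms(1,3) by (intro sum_mono) (simp add: norm_divide dual_orlicz_divide_le)
    also have "\<dots> = (\<Sum>n<N. dual_orlicz (cmod (v n))) / r" by (simp add: sum_divide_distrib)
    also have "\<dots> \<le> 1" using assms(1,3) order_trans[OF assms(2)[of N] assms(3)] by simp
    finally show ?thesis .
  qed
  then have s: "summable (\<lambda>n. dual_orlicz (cmod (v n / of_real r)))"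
    by (intro bounded_imp_summable[of _ 1])
      (auto simp: dual_orlicz_nonneg lessThan_Suc_atMost[symmetric] simp del: sum.lessThan_Suc)
  then show ?thesis using suminf_le_const[OF s, of 1] le by blast
qed

lemma seq_space_eq_sym:
  assumes "X \<cong>\<^sub>s Y"
  shows "Y \<cong>\<^sub>s X"
proof -
  obtain c C where "c > 0" "C > 0"
    "\<forall>x\<in>elems X. c * nrm X x \<le> nrm Y x \<and> nrm Y x \<le> C * nrm X x" "elems X = elems Y"
    using assms by (auto simp: seq_space_eq_def)
  then have "\<forall>x\<in>elems Y. 1 / C * nrm Y x \<le> nrm X x \<and> nrm X x \<le> 1 / c * nrm Y x"
    by (auto simp: field_simps)
  then show ?thesis using \<open>c > 0\<close> \<open>C > 0\<close> \<open>elems X = elems Y\<close>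
    unfolding seq_space_eq_def
    by (intro conjI exI[of _ "1 / C"] exI[of _ "1 / c"]) auto
qed

lemma seq_space_eq_trans:
  assumes "X \<cong>\<^sub>s Y" "Y \<cong>\<^sub>s Z"
  shows "X \<cong>\<^sub>s Z"
proof -
  obtain c C where c: "c > 0" "C > 0"
    "\<And>x. x\<in>elems X \<Longrightarrow> c * nrm X x \<le> nrm Y x \<and> nrm Y x \<le> C * nrm X x" "elems X = elems Y"
    using assms by (auto simp: seq_space_eq_def)
  obtain d D where d: "d > 0" "D > 0"
    "\<And>x. x\<in>elems Y \<Longrightarrow> d * nrm Y x \<le> nrm Z x \<and> nrm Z x \<le> D * nrm Y x" "elems Y = elems Z"
    using assms by (auto simp: seq_space_eq_def)
  have "(d * c) * nrm X x \<le> nrm Z x \<and> nrm Z x \<le> (D * C) * nrm X x" if "x \<in> elems X" for x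
  proof
    have "d * (c * nrm X x) \<le> d * nrm Y x" using c(3)[OF that] d(1) by simp
    then show "(d * c) * nrm X x \<le> nrm Z x" using d(3)[of x] that c(4) by (simp add: mult.assoc)
    have "D * nrm Y x \<le> D * (C * nrm X x)" using c(3)[OF that] d(2) by simp
    then show "nrm Z x \<le> (D * C) * nrm X x" using d(3)[of x] that c(4) by (simp add: mult.assoc)
  qed
  then show ?thesis using c(1,2,4) d(1,2,4)
    unfolding seq_space_eq_def by (metis mult_pos_pos)
qed

text \<open>The norms involved are infima that need not be attained, so \<open>ball\<close> is
  required only for radii strictly above \<open>C * nrm X x\<close>. With this, both inclusions and
  both norm inequalities reduce to statements about the unit ball of the modular.\<close>

lemma seq_space_eq_orlicz_dualI:
  assumes "C > 0"
    and ball: "\<And>x r. x \<in> elems X \<Longrightarrow> r > 0 \<Longrightarrow> C * nrm X x < r \<Longrightarrow> in_unit_ball (\<lambda>n. x n / of_real r)"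
    and nrm: "\<And>x r. r > 0 \<Longrightarrow> in_unit_ball (\<lambda>n. x n / of_real r) \<Longrightarrow> x \<in> elems X \<and> nrm X x \<le> C * r"
    and nonneg: "\<And>x. x \<in> elems X \<Longrightarrow> 0 \<le> nrm X x"
  shows "X \<cong>\<^sub>s orlicz_space dual_orlicz"
proof -
  let ?R = "\<lambda>x. {r :: real. r > 0 \<and> in_unit_ball (\<lambda>n. x n / of_real r)}"
  have R: "?R x = {r. r > 0 \<and> summable (\<lambda>n. dual_orlicz (cmod (x n) / r)) \<and>
                  (\<Sum>n. dual_orlicz (cmod (x n) / r)) \<le> 1}" for x
    by (auto simp: norm_divide)
  have nrmY: "nrm (orlicz_space dual_orlicz) x = Inf (?R x)" for x
    unfolding orlicz_space_def R by simp
  have bdd: "bdd_below (?R x)" for x by (rule bdd_belowI[of _ 0]) auto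
  have "elems X = elems (orlicz_space dual_orlicz)"
  proof (intro set_eqI iffI)
    fix x assume x: "x \<in> elems X"
    define r where "r = C * nrm X x + 1"
    have "r > 0" "C * nrm X x < r"
      using nonneg[OF x] \<open>C > 0\<close> by (auto simp: r_def add_nonneg_pos)
    with ball[OF x this] show "x \<in> elems (orlicz_space dual_orlicz)"
      by (auto simp: orlicz_space_def norm_divide intro!: exI[of _ r])
  next
    fix x assume "x \<in> elems (orlicz_space dual_orlicz)"
    then obtain r where r: "r > 0" "summable (\<lambda>n. dual_orlicz (cmod (x n) / r))"
      by (auto simp: orlicz_space_def)
    let ?S = "\<Sum>n. dual_orlicz (cmod (x n) / r)"
    have "in_unit_ball (\<lambda>n. (x n / of_real r) / of_real (max 1 ?S))"
    proof (rule in_unit_ballI[of "max 1 ?S"])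
      fix N
      have "(\<Sum>n<N. dual_orlicz (cmod (x n / of_real r))) \<le> ?S"
        using r by (simp add: norm_divide) (intro sum_le_suminf; simp add: dual_orlicz_nonneg)
      then show "(\<Sum>n<N. dual_orlicz (cmod (x n / of_real r))) \<le> max 1 ?S" by linarith
    qed auto
    then show "x \<in> elems X"
      using nrm[of "r * max 1 ?S" x] r by (simp add: divide_divide_eq_left)
  qed
  moreover have "1 / C * nrm X x \<le> nrm (orlicz_space dual_orlicz) x \<and>
      nrm (orlicz_space dual_orlicz) x \<le> C * nrm X x" if x: "x \<in> elems X" for x
  proof
    have "C * nrm X x + 1 \<in> ?R x"
      using ball[OF x, of "C * nrm X x + 1"] nonneg[OF x] \<open>C > 0\<close> by (simp only: mem_Collect_eq) (simp add: add_nonneg_pos)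
    then have ne: "?R x \<noteq> {}" by blast
    have "nrm X x / C \<le> Inf (?R x)"
      using nrm[of _ x] \<open>C > 0\<close> by (intro cInf_greatest[OF ne]) (auto simp: field_simps)
    then show "1 / C * nrm X x \<le> nrm (orlicz_space dual_orlicz) x" by (simp add: nrmY)
    have "Inf (?R x) \<le> r" if "C * nrm X x < r" for r
    proof (rule cInf_lower[OF _ bdd])
      have "0 \<le> C * nrm X x" using nonneg[OF x] \<open>C > 0\<close> by simp
      with that have "r > 0" by linarith
      then show "r \<in> ?R x" using ball[OF x _ that] by simp
    qed
    then show "nrm (orlicz_space dual_orlicz) x \<le> C * nrm X x"
      unfolding nrmY by (rule dense_ge)
  qed
  ultimately show ?thesis unfolding seq_space_eq_def using \<open>C > 0\<close>
    by (intro conjI exI[of _ "1 / C"] exI[of _ C] ballI) auto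
qed

subsection \<open>Cauchy estimates on rectangles\<close>

text \<open>The sides of \<open>rectpath a b\<close> in its orientation. A list of segments lets
  integrability, differentiation under the integral and estimates be treated one side at a
  time.\<close>

definition edges :: "complex \<Rightarrow> complex \<Rightarrow> (complex \<times> complex) list" where
  "edges a b = [(a, Complex (Re b) (Im a)), (Complex (Re b) (Im a), b),
                (b, Complex (Re a) (Im b)), (Complex (Re a) (Im b), a)]"

lemma closed_segment_edges_subset:
  assumes "Re a < Re b" "Im a < Im b" "(p, q) \<in> set (edges a b)"
  shows "closed_segment p q \<subseteq> cbox a b - box a b"
proof -
  have "path_image (rectpath a b) = cbox a b - box a b"
    using assms by (intro path_image_rectpath_cbox_minus_box) auto
  moreover have "closed_segment p q \<subseteq> path_image (rectpath a b)"
    using assms by (auto simp: rectpath_def edges_def Let_def path_image_join)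
  ultimately show ?thesis by simp
qed

lemma contour_integrable_edges_kernel:
  assumes "Re a < Re b" "Im a < Im b" "(p, q) \<in> set (edges a b)"
    and "continuous_on (cbox a b) H" "w \<in> box a b"
  shows "(\<lambda>u. H u / (u - w) ^ k) contour_integrable_on linepath p q"
proof (rule contour_integrable_continuous_linepath)
  show "continuous_on (closed_segment p q) (\<lambda>u. H u / (u - w) ^ k)"
    using closed_segment_edges_subset[OF assms(1-3)] assms(4,5)
    by (intro continuous_intros continuous_on_subset[OF assms(4)]) auto
qed

lemma sum_list_has_field_derivative:
  assumes "\<And>x. x \<in> set xs \<Longrightarrow> ((f x) has_field_derivative (f' x)) F"
  shows "((\<lambda>w. \<Sum>x\<leftarrow>xs. f x w) has_field_derivative (\<Sum>x\<leftarrow>xs. f' x)) F"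
  using assms by (induction xs) (auto intro!: derivative_eq_intros)

text \<open>The vertical sides will lie on the boundary of the strip, where functions of the
  Calderon space are continuous but need not be holomorphic. Hence the hypotheses on
  \<open>H\<close>; the induction starts from Cauchy's formula in this weak form and differentiates
  the kernel in \<open>w\<close> under the integral.\<close>

lemma higher_deriv_rectangle:
  assumes ab: "Re a < Re b" "Im a < Im b"
    and H: "continuous_on (cbox a b) H" "H holomorphic_on box a b"
    and w: "w \<in> box a b"
  shows "2 * pi * \<i> * (deriv ^^ k) H w / fact k
         = (\<Sum>(p, q)\<leftarrow>edges a b. contour_integral (linepath p q) (\<lambda>u. H u / (u - w) ^ Suc k))"
  using w
proof (induction k arbitrary: w)
  case 0
  let ?f = "\<lambda>u. H u / (u - w)"
  have int: "?f contour_integrable_on linepath p q" if "(p, q) \<in> set (edges a b)" for p q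
    using contour_integrable_edges_kernel[OF ab that H(1) 0, of 1] by simp
  have "(?f has_contour_integral 2 * pi * \<i> * winding_number (rectpath a b) w * H w) (rectpath a b)"
  proof (rule Cauchy_integral_formula_weak[where S = "cbox a b" and k = "{}"])
    show "path_image (rectpath a b) \<subseteq> cbox a b - {w}"
      using ab 0 by (subst path_image_rectpath_cbox_minus_box) auto
    show "H field_differentiable at x" if "x \<in> interior (cbox a b) - {}" for x
      using that holomorphic_on_imp_differentiable_at[OF H(2) open_box] by simp
  qed (use 0 H in \<open>auto simp: convex_box\<close>)
  then have "contour_integral (rectpath a b) ?f = 2 * pi * \<i> * H w"
    using 0 by (simp add: winding_number_rectpath contour_integral_unique)
  moreover have "contour_integral (rectpath a b) ?f
      = (\<Sum>(p, q)\<leftarrow>edges a b. contour_integral (linepath p q) ?f)"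
    using int by (simp add: rectpath_def edges_def Let_def contour_integrable_join add_ac)
  ultimately show ?case by simp
next
  case (Suc k)
  let ?I = "\<lambda>k w (p, q). contour_integral (linepath p q) (\<lambda>u. H u / (u - w) ^ k)"
  have "((\<lambda>w. ?I (Suc k) w e) has_field_derivative Suc k * ?I (Suc (Suc k)) w e) (at w)"
    if "e \<in> set (edges a b)" for e
  proof (cases e)
    case (Pair p q)
    with that have pq: "(p, q) \<in> set (edges a b)" by simp
    note sub = closed_segment_edges_subset[OF ab pq]
    have "((\<lambda>w. contour_integral (linepath p q) (\<lambda>u. H u / (u - w) ^ Suc k)) has_field_derivative
        Suc k * contour_integral (linepath p q) (\<lambda>u. H u / (u - w) ^ Suc (Suc k))) (at w)"
    proof (rule Cauchy_next_derivative(2)[where B = "cmod (q - p)" and S = "box a b"])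
      show "continuous_on (path_image (linepath p q)) H"
        using sub by (auto intro: continuous_on_subset[OF H(1)])
      show "((\<lambda>u. H u / (u - x) ^ Suc k) has_contour_integral
              contour_integral (linepath p q) (\<lambda>u. H u / (u - x) ^ Suc k)) (linepath p q)"
        if "x \<in> box a b - path_image (linepath p q)" for x
        using contour_integrable_edges_kernel[OF ab pq H(1)] that
        by (intro has_contour_integral_integral) (auto simp del: power_Suc)
    qed (use Suc.prems sub in auto)
    then show ?thesis by (simp add: Pair)
  qed
  from sum_list_has_field_derivative[OF this]
  have "((\<lambda>w. \<Sum>e\<leftarrow>edges a b. ?I (Suc k) w e) has_field_derivative
         (\<Sum>e\<leftarrow>edges a b. Suc k * ?I (Suc (Suc k)) w e)) (at w)" .
  moreover have "\<forall>\<^sub>F w in nhds w. (\<Sum>e\<leftarrow>edges a b. ?I (Suc k) w e) = 2 * pi * \<i> * (deriv ^^ k) H w / fact k"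
    using eventually_nhds_in_open[OF open_box Suc.prems]
    by (rule eventually_mono) (use Suc.IH in \<open>simp add: case_prod_unfold\<close>)
  ultimately have "((\<lambda>w. 2 * pi * \<i> * (deriv ^^ k) H w / fact k) has_field_derivative
         (\<Sum>e\<leftarrow>edges a b. Suc k * ?I (Suc (Suc k)) w e)) (at w)"
    by (subst (asm) DERIV_cong_ev) auto
  moreover have "((\<lambda>w. 2 * pi * \<i> * (deriv ^^ k) H w / fact k) has_field_derivative
         (2 * pi * \<i> * (deriv ^^ Suc k) H w / fact k)) (at w)"
    using holomorphic_derivI[OF holomorphic_higher_deriv[OF H(2) open_box] open_box Suc.prems]
    by (auto intro!: derivative_eq_intros)
  ultimately have "2 * pi * \<i> * (deriv ^^ Suc k) H w / fact k
      = (\<Sum>e\<leftarrow>edges a b. Suc k * ?I (Suc (Suc k)) w e)"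
    by (rule DERIV_unique[rotated])
  also have "\<dots> = Suc k * (\<Sum>e\<leftarrow>edges a b. ?I (Suc (Suc k)) w e)"
    by (simp add: sum_list_const_mult)
  finally show ?case by (simp add: case_prod_unfold field_simps del: of_nat_Suc)
qed

lemma norm_sum_list_le: "norm (\<Sum>x\<leftarrow>xs. f x) \<le> (\<Sum>x\<leftarrow>xs. norm (f x))"
  by (induction xs) (auto intro: norm_triangle_le)

text \<open>The modulus of \<open>H\<close> stays under the integral: on the line
  \<open>Re z = 1\<close> the sharp information about a single coordinate is its mean, not its
  supremum.\<close>

lemma norm_higher_deriv_rectangle_le:
  assumes ab: "Re a < Re b" "Im a < Im b"
    and H: "continuous_on (cbox a b) H" "H holomorphic_on box a b"
    and w: "w \<in> box a b"
    and d: "d > 0" "\<And>u. u \<in> cbox a b - box a b \<Longrightarrow> d \<le> cmod (u - w)"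
  shows "2 * pi * cmod ((deriv ^^ k) H w / fact k)
    \<le> (\<Sum>(p, q)\<leftarrow>edges a b. integral {0..1} (\<lambda>x. cmod (H (linepath p q x)) * cmod (q - p))) / d ^ Suc k"
proof -
  have bd: "cmod (contour_integral (linepath p q) (\<lambda>u. H u / (u - w) ^ Suc k))
      \<le> integral {0..1} (\<lambda>x. cmod (H (linepath p q x)) * cmod (q - p)) / d ^ Suc k"
    if pq: "(p, q) \<in> set (edges a b)" for p q
  proof -
    note sub = closed_segment_edges_subset[OF ab pq]
    have lp: "linepath p q x \<in> cbox a b - box a b" if "x \<in> {0..1}" for x
      using sub that linepath_in_path by blast
    have int: "(\<lambda>u. H u / (u - w) ^ Suc k) contour_integrable_on linepath p q"
      by (rule contour_integrable_edges_kernel[OF ab pq H(1) w])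
    have contH: "continuous_on {0..1} (\<lambda>x. H (linepath p q x))"
      using lp by (intro continuous_on_compose2[OF H(1)] continuous_on_linepath) auto
    have "contour_integral (linepath p q) (\<lambda>u. H u / (u - w) ^ Suc k)
        = integral {0..1} (\<lambda>x. H (linepath p q x) / (linepath p q x - w) ^ Suc k * (q - p))"
      by (simp add: contour_integral_integral)
    also have "cmod \<dots> \<le> integral {0..1} (\<lambda>x. cmod (H (linepath p q x)) * cmod (q - p) / d ^ Suc k)"
    proof (rule integral_norm_bound_integral)
      show "(\<lambda>x. H (linepath p q x) / (linepath p q x - w) ^ Suc k * (q - p)) integrable_on {0..1}"
        using int by (simp add: contour_integrable_on)
      show "(\<lambda>x. cmod (H (linepath p q x)) * cmod (q - p) / d ^ Suc k) integrable_on {0..1}"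
        by (intro integrable_continuous_real continuous_intros contH) (use d in auto)
      fix x :: real assume "x \<in> {0..1}"
      then have "d ^ Suc k \<le> cmod (linepath p q x - w) ^ Suc k"
        using d lp by (intro power_mono) auto
      then show "cmod (H (linepath p q x) / (linepath p q x - w) ^ Suc k * (q - p))
                   \<le> cmod (H (linepath p q x)) * cmod (q - p) / d ^ Suc k"
        using d by (auto simp: norm_mult norm_divide norm_power intro!: frac_le mult_nonneg_nonneg simp del: power_Suc)
    qed
    finally show ?thesis by (simp add: integral_divide)
  qed
  have "2 * pi * cmod ((deriv ^^ k) H w / fact k) = cmod (2 * pi * \<i> * (deriv ^^ k) H w / fact k)"
    by (simp add: norm_mult norm_divide)
  also have "\<dots> \<le> (\<Sum>e\<leftarrow>edges a b. cmod (case e of (p, q) \<Rightarrow>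
                 contour_integral (linepath p q) (\<lambda>u. H u / (u - w) ^ Suc k)))"
    unfolding higher_deriv_rectangle[OF ab H w] by (rule norm_sum_list_le)
  also have "\<dots> \<le> (\<Sum>e\<leftarrow>edges a b. case e of (p, q) \<Rightarrow>
                 integral {0..1} (\<lambda>x. cmod (H (linepath p q x)) * cmod (q - p)) / d ^ Suc k)"
    using bd by (intro sum_list_mono) auto
  also have "\<dots> = (\<Sum>(p, q)\<leftarrow>edges a b. integral {0..1} (\<lambda>x. cmod (H (linepath p q x)) * cmod (q - p))) / d ^ Suc k"
    by (simp add: case_prod_unfold edges_def add_divide_distrib)
  finally show ?thesis .
qed

subsection \<open>Upper estimate for the second derivative\<close>

text \<open>The substitution \<open>t = 2 * R * x - R\<close> carries the unit interval, over which
  \<open>linepath\<close> runs, to \<open>[-R, R]\<close>; the integrand is the density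
  \<open>1 / (1 + t^2)\<close> times its Jacobian.\<close>

lemma has_integral_arctan_line:
  assumes "R > 0"
  shows "((\<lambda>x. 2 * R / (1 + (2 * R * x - R)\<^sup>2)) has_integral 2 * arctan R) {0..1}"
proof -
  have "((\<lambda>x. 2 * R / (1 + (2 * R * x - R)\<^sup>2)) has_integral
          arctan (2 * R * 1 - R) - arctan (2 * R * 0 - R)) {0..1}"
    by (rule fundamental_theorem_of_calculus)
      (auto intro!: derivative_eq_intros simp: has_real_derivative_iff_has_vector_derivative[symmetric] divide_inverse algebra_simps)
  then show ?thesis by (simp add: arctan_minus)
qed

lemma half_le_dist_rectangle_edge:
  assumes "R \<ge> 1/2" "u \<in> cbox (Complex 0 (-R)) (Complex 1 R) - box (Complex 0 (-R)) (Complex 1 R)"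
  shows "1/2 \<le> cmod (u - 1/2)"
proof -
  have "1/2 \<le> \<bar>Re (u - 1/2)\<bar> \<or> 1/2 \<le> \<bar>Im (u - 1/2)\<bar>"
    using assms by (auto simp: in_cbox_complex_iff in_box_complex_iff)
  then show ?thesis using abs_Re_le_cmod[of "u - 1/2"] abs_Im_le_cmod[of "u - 1/2"] by linarith
qed

lemma exp_half_ln:
  assumes "m > 0"
  shows "exp (complex_of_real (ln m) / 2) = of_real (sqrt m)"
proof -
  have "exp (ln (sqrt m)) = sqrt m" using assms by simp
  then have "exp (ln m / 2) = sqrt m" using assms by (simp only: ln_sqrt)
  then have "complex_of_real (exp (ln m / 2)) = of_real (sqrt m)" by simp
  then show ?thesis by (simp only: exp_of_real[symmetric] of_real_divide of_real_numeral)
qed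

text \<open>
  Dividing by the outer function \<open>m\<^sup>z\<close> makes the two boundary integrals comparable, so that the Taylor
  coefficients of the quotient are bounded; the vanishing coefficient of \<open>\<phi>\<close> then cancels the
  term of order \<open>(ln m)\<^sup>2\<close> in the second derivative.
\<close>

lemma second_coeff_le:
  assumes cont: "continuous_on strip \<phi>" and hol: "\<phi> holomorphic_on open_strip"
    and B: "\<And>z. z \<in> strip \<Longrightarrow> cmod (\<phi> z) \<le> B"
    and left: "\<And>t. cmod (\<phi> (Complex 0 t)) \<le> 1"
    and R: "R \<ge> 1/2" and m: "0 < m" "m \<le> 1" and mR: "2 * B \<le> m * (1 + R\<^sup>2)"
    and right: "integral {0..1} (\<lambda>x. cmod (\<phi> (Complex 1 (2 * R * x - R))) * (2 * R / (1 + (2 * R * x - R)\<^sup>2)))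
                  \<le> 5 * m"
    and vanish: "\<phi> (1/2) = 0 \<or> deriv \<phi> (1/2) = 0"
  shows "cmod ((deriv ^^ 2) \<phi> (1/2) / 2) \<le> 48 * (sqrt m * (1 - ln m))"
proof -
  define L where "L = ln m"
  have L0: "L \<le> 0" using m by (simp add: L_def)
  \<comment> \<open>The last factor is \<open>m\<close> to the power \<open>- u\<close>: it has
    modulus 1 on the left side and \<open>1 / m\<close> on the right side, where the mean of
    \<open>\<phi>\<close> is of order \<open>m\<close>.\<close>
  define H where "H = (\<lambda>u. \<phi> u * exp ((u - 1/2)\<^sup>2) * exp (- (of_real L * u)))"
  define a b where "a = Complex 0 (-R)" and "b = Complex 1 R"
  have ab: "Re a < Re b" "Im a < Im b" "1/2 \<in> box a b"
    using R by (auto simp: a_def b_def in_box_complex_iff)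
  have sub: "cbox a b \<subseteq> strip" "box a b \<subseteq> open_strip"
    by (auto simp: a_def b_def strip_def open_strip_def in_cbox_complex_iff in_box_complex_iff)
  have contH: "continuous_on (cbox a b) H"
    unfolding H_def by (intro continuous_intros continuous_on_subset[OF cont sub(1)])
  have holH: "H holomorphic_on open_strip"
    unfolding H_def by (intro holomorphic_intros hol)
  have nH: "cmod (H u) \<le> cmod (\<phi> u) * (2 / (1 + (Im u)\<^sup>2)) * exp (- (L * Re u))" if "u \<in> strip" for u
    unfolding H_def norm_mult
    by (intro mult_mono norm_exp_centered_square_le that) (auto intro!: mult_nonneg_nonneg simp: add_nonneg_nonneg)
  have intH: "(\<lambda>x. cmod (H (linepath p q x)) * cmod (q - p)) integrable_on {0..1}"
    if "(p, q) \<in> set (edges a b)" for p q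
  proof -
    have "linepath p q x \<in> cbox a b" if "x \<in> {0..1}" for x
      using closed_segment_edges_subset[OF ab(1,2) \<open>(p, q) \<in> set (edges a b)\<close>]
        linepath_in_path[OF that, of p q] by blast
    then show ?thesis
      by (intro integrable_continuous_real continuous_intros continuous_on_compose2[OF contH] continuous_on_linepath) auto
  qed
  \<comment> \<open>On these two sides only the crude bound \<open>B\<close> is available, and the
    outer factor may be as large as \<open>1 / m\<close>. The Gaussian contributes
    \<open>2 / (1 + R^2)\<close>, and \<open>mR\<close> says precisely that the product is at most
    1.\<close>
  have horizontal: "integral {0..1} (\<lambda>x. cmod (H (linepath p q x)) * cmod (q - p)) \<le> 1"
    if pq: "(p, q) \<in> set (edges a b)" and "cmod (q - p) = 1" and "\<bar>Im p\<bar> = R" "Im q = Im p" for p q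
  proof -
    have "integral {0..1} (\<lambda>x. cmod (H (linepath p q x)) * cmod (q - p)) \<le> integral {0..1} (\<lambda>x::real. 1)"
    proof (rule integral_le[OF intH[OF pq]])
      fix x :: real assume x: "x \<in> {0..1}"
      let ?u = "linepath p q x"
      have u: "?u \<in> strip"
        using closed_segment_edges_subset[OF ab(1,2) pq] linepath_in_path[OF x, of p q] sub by blast
      have "Im ?u = Im p" using that by (simp add: linepath_def algebra_simps)
      then have Im: "(Im ?u)\<^sup>2 = R\<^sup>2" using that by (metis power2_abs)
      have "- (L * Re ?u) \<le> - L"
        using u L0 by (auto simp: strip_def mult_le_cancel_left2 mult_le_cancel_left1)
      then have "exp (- (L * Re ?u)) \<le> exp (- L)" by simp
      then have "exp (- (L * Re ?u)) \<le> 1 / m" using m by (simp add: L_def exp_minus inverse_eq_divide)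
      then have "cmod (H ?u) \<le> B * (2 / (1 + R\<^sup>2)) * (1 / m)"
        using B[OF u] Im order_trans[OF norm_ge_zero B[OF u]]
        by (intro order_trans[OF nH[OF u]] mult_mono) (auto intro!: divide_nonneg_nonneg simp: add_nonneg_nonneg)
      also have "\<dots> \<le> 1" using mR m by (simp add: divide_le_eq add_pos_nonneg mult.commute)
      finally show "cmod (H ?u) * cmod (q - p) \<le> 1" using that by simp
    qed auto
    then show ?thesis by simp
  qed
  have vertical_right: "integral {0..1} (\<lambda>x. cmod (H (linepath (Complex 1 (-R)) b x)) * cmod (b - Complex 1 (-R))) \<le> 10"
  proof -
    let ?p = "Complex 1 (-R)"
    have line: "linepath ?p b x = Complex 1 (2 * R * x - R)" for x
      by (simp add: linepath_def b_def complex_eq_iff algebra_simps)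
    have len: "cmod (b - ?p) = 2 * R" using R by (simp add: b_def cmod_def real_sqrt_mult)
    have pq: "(?p, b) \<in> set (edges a b)" by (simp add: edges_def a_def b_def)
    let ?g = "\<lambda>x. cmod (\<phi> (Complex 1 (2 * R * x - R))) * (2 * R / (1 + (2 * R * x - R)\<^sup>2))"
    have contg: "continuous_on {0..1} ?g"
    proof -
      have "continuous_on {0..1} (\<lambda>x. \<phi> (Complex 1 (2 * R * x - R)))"
        by (rule continuous_on_compose2[OF cont]) (auto simp: strip_def Complex_eq intro!: continuous_intros)
      then show ?thesis by (intro continuous_intros) (auto simp: add_nonneg_eq_0_iff)
    qed
    have "integral {0..1} (\<lambda>x. cmod (H (linepath ?p b x)) * cmod (b - ?p)) \<le> integral {0..1} (\<lambda>x. 2 / m * ?g x)"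
    proof (rule integral_le[OF intH[OF pq]])
      show "(\<lambda>x. 2 / m * ?g x) integrable_on {0..1}"
        by (intro integrable_continuous_real continuous_on_mult_left contg)
      fix x :: real
      let ?u = "Complex 1 (2 * R * x - R)"
      have "cmod (H ?u) \<le> cmod (\<phi> ?u) * (2 / (1 + (2 * R * x - R)\<^sup>2)) * (1 / m)"
        using nH[of ?u] m by (simp add: strip_def L_def exp_minus inverse_eq_divide)
      then have "cmod (H ?u) * (2 * R) \<le> cmod (\<phi> ?u) * (2 / (1 + (2 * R * x - R)\<^sup>2)) * (1 / m) * (2 * R)"
        using R by (intro mult_right_mono) auto
      then show "cmod (H (linepath ?p b x)) * cmod (b - ?p) \<le> 2 / m * ?g x"
        by (simp add: line len mult_ac)
    qed
    also have "\<dots> = 2 / m * integral {0..1} ?g" by (rule integral_mult_right)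
    also have "\<dots> \<le> 2 / m * (5 * m)" using right m by (intro mult_left_mono) auto
    finally show ?thesis using m by simp
  qed
  have vertical_left: "integral {0..1} (\<lambda>x. cmod (H (linepath (Complex 0 R) a x)) * cmod (a - Complex 0 R)) \<le> 2 * pi"
  proof -
    let ?p = "Complex 0 R"
    have line: "linepath ?p a x = Complex 0 (- (2 * R * x - R))" for x
      by (simp add: linepath_def a_def complex_eq_iff algebra_simps)
    have len: "cmod (a - ?p) = 2 * R" using R by (simp add: a_def cmod_def real_sqrt_mult)
    have pq: "(?p, a) \<in> set (edges a b)" by (simp add: edges_def a_def b_def)
    have int: "((\<lambda>x. 2 * (2 * R / (1 + (2 * R * x - R)\<^sup>2))) has_integral 2 * (2 * arctan R)) {0..1}"
      using R by (intro has_integral_mult_right has_integral_arctan_line) auto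
    have "integral {0..1} (\<lambda>x. cmod (H (linepath ?p a x)) * cmod (a - ?p)) \<le> 2 * (2 * arctan R)"
    proof (rule has_integral_le[OF integrable_integral[OF intH[OF pq]] int])
      fix x :: real
      let ?u = "Complex 0 (- (2 * R * x - R))"
      have "cmod (H ?u) \<le> cmod (\<phi> ?u) * (2 / (1 + (2 * R * x - R)\<^sup>2))"
        using nH[of ?u] by (simp add: strip_def power2_commute)
      also have "\<dots> \<le> 1 * (2 / (1 + (2 * R * x - R)\<^sup>2))"
        by (intro mult_right_mono left) (auto simp: add_nonneg_nonneg)
      finally have "cmod (H ?u) * (2 * R) \<le> 2 / (1 + (2 * R * x - R)\<^sup>2) * (2 * R)"
        using R by (intro mult_right_mono) auto
      then show "cmod (H (linepath ?p a x)) * cmod (a - ?p) \<le> 2 * (2 * R / (1 + (2 * R * x - R)\<^sup>2))"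
        by (simp add: line len mult_ac)
    qed
    then show ?thesis using arctan_bounded[of R] by simp
  qed
  have edges_eq: "edges a b = [(a, Complex 1 (-R)), (Complex 1 (-R), b), (b, Complex 0 R), (Complex 0 R, a)]"
    by (simp add: edges_def a_def b_def)
  \<comment> \<open>The sides contribute at most \<open>1 + 10 + 1 + 2 * pi\<close>, and
    \<open>12 \<le> 4 * pi\<close>.\<close>
  have edge_sum: "(\<Sum>(p, q)\<leftarrow>edges a b. integral {0..1} (\<lambda>x. cmod (H (linepath p q x)) * cmod (q - p))) \<le> 6 * pi"
  proof -
    have "integral {0..1} (\<lambda>x. cmod (H (linepath a (Complex 1 (-R)) x)) * cmod (Complex 1 (-R) - a)) \<le> 1"
      "integral {0..1} (\<lambda>x. cmod (H (linepath b (Complex 0 R) x)) * cmod (Complex 0 R - b)) \<le> 1"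
      using R by (intro horizontal; simp add: edges_eq; simp add: a_def b_def cmod_def)+
    then show ?thesis unfolding edges_eq
      using vertical_right vertical_left pi_gt3 by simp
  qed
  have coeff: "cmod ((deriv ^^ k) H (1/2) / fact k) \<le> 24" if "k \<le> 2" for k
  proof -
    have "2 * pi * cmod ((deriv ^^ k) H (1/2) / fact k) \<le> 6 * pi / (1/2) ^ Suc k"
      using half_le_dist_rectangle_edge[OF R]
      by (intro order_trans[OF norm_higher_deriv_rectangle_le[OF ab(1,2) contH
             holomorphic_on_subset[OF holH sub(2)] ab(3), where d = "1/2"]] divide_right_mono edge_sum)
        (auto simp: a_def b_def)
    also have "\<dots> = 2 * pi * (3 * 2 ^ Suc k)" by (simp add: power_divide)
    finally have "cmod ((deriv ^^ k) H (1/2) / fact k) \<le> 3 * 2 ^ Suc k"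
      by (subst (asm) mult_le_cancel_left_pos) auto
    also have "\<dots> \<le> 3 * 2 ^ 3" using that by (intro mult_left_mono power_increasing) auto
    finally show ?thesis by simp
  qed
  define h0 h1 h2 where "h0 = H (1/2)" and "h1 = deriv H (1/2)" and "h2 = (deriv ^^ 2) H (1/2) / 2"
  have h: "cmod h0 \<le> 24" "cmod h1 \<le> 24" "cmod h2 \<le> 24"
    using coeff[of 0] coeff[of 1] coeff[of 2] by (auto simp: h0_def h1_def h2_def)
  \<comment> \<open>The reciprocal of the factor in \<open>H\<close>. Because the Gaussian is
    centred at \<open>1/2\<close>, its exponent has derivative 0 there, and the logarithmic
    derivative of \<open>E\<close> at \<open>1/2\<close> is exactly \<open>L\<close>.\<close>
  define E where "E = (\<lambda>u :: complex. exp (of_real L * u - (u - 1/2)\<^sup>2))"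
  have \<phi>: "\<phi> u = E u * H u" for u
  proof -
    have "E u * (exp ((u - 1/2)\<^sup>2) * exp (- (of_real L * u))) = 1"
      by (simp only: E_def exp_add[symmetric]) simp
    then have "\<phi> u = \<phi> u * (E u * (exp ((u - 1/2)\<^sup>2) * exp (- (of_real L * u))))" by simp
    also have "\<dots> = E u * H u" by (simp only: H_def mult_ac)
    finally show ?thesis .
  qed
  have E: "(E has_field_derivative (of_real L - 2 * (u - 1/2)) * E u) (at u)" for u
    unfolding E_def by (auto intro!: derivative_eq_intros simp: algebra_simps)
  have Ec: "E (1/2) = of_real (sqrt m)"
    using exp_half_ln[OF m(1)] by (simp add: E_def L_def)
  note dH = holomorphic_derivI[OF holH open_open_strip]
  have d\<phi>: "deriv \<phi> u = (of_real L - 2 * (u - 1/2)) * E u * H u + E u * deriv H u" if "u \<in> open_strip" for u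
  proof -
    have "((\<lambda>u. E u * H u) has_field_derivative (of_real L - 2 * (u - 1/2)) * E u * H u + E u * deriv H u) (at u)"
      using that by (auto intro!: derivative_eq_intros E dH)
    moreover have "(\<lambda>u. E u * H u) = \<phi>" by (rule ext) (rule \<phi>[symmetric])
    ultimately show ?thesis by (simp add: DERIV_imp_deriv)
  qed
  have c: "1/2 \<in> open_strip" by (simp add: open_strip_def)
  have "deriv (deriv \<phi>) (1/2) = deriv (\<lambda>u. (of_real L - 2 * (u - 1/2)) * E u * H u + E u * deriv H u) (1/2)"
    using d\<phi> by (intro deriv_cong_ev eventually_mono[OF eventually_nhds_in_open[OF open_open_strip c]]) auto
  also have "\<dots> = of_real (sqrt m) * (((of_real L)\<^sup>2 - 2) * h0 + 2 * of_real L * h1 + 2 * h2)"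
  proof (rule DERIV_imp_deriv)
    have "((\<lambda>u. (of_real L - 2 * (u - 1/2)) * E u * H u + E u * deriv H u) has_field_derivative
        ((- 2 * E (1/2) + (of_real L - 2 * (1/2 - 1/2)) * ((of_real L - 2 * (1/2 - 1/2)) * E (1/2))) * H (1/2)
         + (of_real L - 2 * (1/2 - 1/2)) * E (1/2) * deriv H (1/2)
         + ((of_real L - 2 * (1/2 - 1/2)) * E (1/2) * deriv H (1/2) + E (1/2) * deriv (deriv H) (1/2)))) (at (1/2))"
      using c by (auto intro!: derivative_eq_intros E dH holomorphic_derivI[OF holomorphic_deriv[OF holH open_open_strip] open_open_strip])
    then show "((\<lambda>u. (of_real L - 2 * (u - 1/2)) * E u * H u + E u * deriv H u) has_field_derivative
        of_real (sqrt m) * (((of_real L)\<^sup>2 - 2) * h0 + 2 * of_real L * h1 + 2 * h2)) (at (1/2))"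
      by (rule DERIV_cong) (simp add: Ec h0_def h1_def h2_def numeral_2_eq_2 algebra_simps power2_eq_square)
  qed
  finally have d2: "(deriv ^^ 2) \<phi> (1/2) / 2
      = of_real (sqrt m) * (((of_real L)\<^sup>2 / 2 - 1) * h0 + of_real L * h1 + h2)"
    by (simp add: numeral_2_eq_2 field_simps)
  have sqm: "sqrt m > 0" using m by simp
  have "cmod (((of_real L)\<^sup>2 / 2 - 1) * h0 + of_real L * h1 + h2) \<le> 48 * (1 - L)"
    using vanish
  proof
    assume "\<phi> (1/2) = 0"
    then have "h0 = 0" using \<phi>[of "1/2"] Ec sqm by (simp add: h0_def)
    then have "cmod (((of_real L)\<^sup>2 / 2 - 1) * h0 + of_real L * h1 + h2) \<le> \<bar>L\<bar> * cmod h1 + cmod h2"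
      using norm_triangle_ineq[of "of_real L * h1" h2] by (simp add: norm_mult)
    also have "\<dots> \<le> \<bar>L\<bar> * 24 + 24" using h by (intro add_mono mult_left_mono) auto
    finally show ?thesis using L0 by simp
  next
    assume "deriv \<phi> (1/2) = 0"
    then have "of_real (sqrt m) * (of_real L * h0 + h1) = 0"
      using d\<phi>[OF c] by (simp add: Ec h0_def h1_def algebra_simps)
    then have "of_real L * h0 + h1 = 0" using sqm by simp
    \<comment> \<open>Now \<open>L * h0 = - h1\<close>, so the quadratic term
      \<open>L^2 * h0 / 2\<close> equals \<open>- L * h1 / 2\<close>; only half of the linear term
      survives.\<close>
    then have h1: "h1 = - (of_real L * h0)" by (simp only: add_eq_0_iff)
    have "((of_real L)\<^sup>2 / 2 - 1) * h0 + of_real L * h1 + h2 = of_real L * h1 / 2 + h2 - h0"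
      unfolding h1 by (simp add: algebra_simps power2_eq_square)
    also have "cmod \<dots> \<le> \<bar>L\<bar> * cmod h1 / 2 + cmod h2 + cmod h0"
      using norm_triangle_ineq4[of "of_real L * h1 / 2 + h2" h0] norm_triangle_ineq[of "of_real L * h1 / 2" h2]
      by (simp add: norm_mult norm_divide)
    also have "\<dots> \<le> \<bar>L\<bar> * 24 / 2 + 24 + 24" using h by (intro add_mono divide_right_mono mult_left_mono) auto
    finally show ?thesis using L0 by simp
  qed
  then have "sqrt m * cmod (((of_real L)\<^sup>2 / 2 - 1) * h0 + of_real L * h1 + h2) \<le> sqrt m * (48 * (1 - L))"
    using sqm by (intro mult_left_mono) auto
  then show ?thesis using sqm by (simp add: d2 norm_mult L_def mult_ac)
qed

text \<open>The bound is independent of \<open>N\<close> and of \<open>B\<close>: the latter enters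
  only the length of the rectangle. This lets \<open>N\<close> grow although \<open>B\<close> is not
  controlled by the Calderon norm in the hypotheses.\<close>

lemma sum_dual_orlicz_second_coeff_le:
  fixes \<phi> :: "nat \<Rightarrow> complex \<Rightarrow> complex"
  assumes cont: "\<And>n. continuous_on strip (\<phi> n)" and hol: "\<And>n. \<phi> n holomorphic_on open_strip"
    and B: "\<And>n z. z \<in> strip \<Longrightarrow> cmod (\<phi> n z) \<le> B"
    and left: "\<And>n t. cmod (\<phi> n (Complex 0 t)) \<le> 1"
    and right: "\<And>t. (\<Sum>n<N. cmod (\<phi> n (Complex 1 t))) \<le> 1"
    and vanish: "\<And>n. \<phi> n (1/2) = 0 \<or> deriv (\<phi> n) (1/2) = 0"
  shows "(\<Sum>n<N. dual_orlicz (cmod ((deriv ^^ 2) (\<phi> n) (1/2) / 2) / 48)) \<le> 16"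
proof (cases "N = 0")
  case False
  have B0: "B \<ge> 0" using order_trans[OF norm_ge_zero B[of 0 0]] by (simp add: strip_def)
  \<comment> \<open>Expanding the square gives \<open>10 * N * B \<le> 1 + R^2\<close>, hence
    \<open>2 * B \<le> m n * (1 + R^2)\<close> as soon as \<open>m n\<close> is at least
    \<open>1 / (5 * N)\<close>.\<close>
  define R where "R = 1/2 + 10 * real N * B"
  have R: "R \<ge> 1/2" using B0 by (simp add: R_def)
  define p where "p = (\<lambda>x::real. 2 * R / (1 + (2 * R * x - R)\<^sup>2))"
  have p0: "p x \<ge> 0" for x using R by (simp add: p_def add_nonneg_nonneg)
  have contp: "continuous_on {0..1} p"
    unfolding p_def by (intro continuous_intros) (auto simp: add_nonneg_eq_0_iff)
  define I where "I = (\<lambda>n. integral {0..1} (\<lambda>x. cmod (\<phi> n (Complex 1 (2 * R * x - R))) * p x))"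
  have int: "(\<lambda>x. cmod (\<phi> n (Complex 1 (2 * R * x - R))) * p x) integrable_on {0..1}" for n
  proof (intro integrable_continuous_real continuous_on_mult contp continuous_on_norm)
    show "continuous_on {0..1} (\<lambda>x. \<phi> n (Complex 1 (2 * R * x - R)))"
      by (rule continuous_on_compose2[OF cont]) (auto simp: strip_def Complex_eq intro!: continuous_intros)
  qed
  have I0: "I n \<ge> 0" for n
    unfolding I_def using p0 by (intro integral_nonneg int) auto
  have pint: "(p has_integral 2 * arctan R) {0..1}"
    using has_integral_arctan_line[of R] R by (simp add: p_def)
  have "(\<Sum>n<N. I n) = integral {0..1} (\<lambda>x. \<Sum>n<N. cmod (\<phi> n (Complex 1 (2 * R * x - R))) * p x)"
    unfolding I_def by (intro integral_sum[symmetric] int) auto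
  also have "\<dots> \<le> integral {0..1} p"
  proof (rule integral_le)
    fix x :: real
    have "(\<Sum>n<N. cmod (\<phi> n (Complex 1 (2 * R * x - R)))) * p x \<le> 1 * p x"
      by (intro mult_right_mono right p0)
    then show "(\<Sum>n<N. cmod (\<phi> n (Complex 1 (2 * R * x - R))) * p x) \<le> p x"
      by (simp add: sum_distrib_right)
  qed (use pint in \<open>auto intro!: integrable_sum int\<close>)
  also have "\<dots> = 2 * arctan R" using pint by (rule integral_unique)
  also have "\<dots> \<le> 4" using arctan_bounded[of R] pi_less_4 by linarith
  finally have sumI: "(\<Sum>n<N. I n) \<le> 4" .
  \<comment> \<open>The summand \<open>1 / N\<close> keeps \<open>m n\<close> positive when the mean
    \<open>I n\<close> vanishes and adds only 1 to the total. The means sum to at most 4, so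
    dividing by 5 brings the total to at most 1.\<close>
  define m where "m = (\<lambda>n. (1 / real N + I n) / 5)"
  have m0: "m n > 0" for n using I0[of n] False by (simp add: m_def add_pos_nonneg)
  have "(\<Sum>n<N. m n) = (1 + (\<Sum>n<N. I n)) / 5"
    using False by (simp add: m_def sum.distrib flip: sum_divide_distrib)
  then have summ: "(\<Sum>n<N. m n) \<le> 1" using sumI by simp
  have m1: "m n \<le> 1" if "n < N" for n
    using member_le_sum[of n "{..<N}" m] that m0 summ by (force simp: less_imp_le)
  have "dual_orlicz (cmod ((deriv ^^ 2) (\<phi> n) (1/2) / 2) / 48) \<le> 16 * m n" if "n < N" for n
  proof -
    have "2 * B \<le> m n * (1 + R\<^sup>2)"
    proof -
      have "10 * real N * B \<le> 1 + R\<^sup>2"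
        using B0 by (auto simp: R_def power2_eq_square algebra_simps intro!: add_nonneg_nonneg)
      then have "2 * B \<le> 1 / real N / 5 * (1 + R\<^sup>2)" using False by (simp add: field_simps)
      also have "\<dots> \<le> m n * (1 + R\<^sup>2)"
        using I0[of n] by (intro mult_right_mono) (auto simp: m_def add_nonneg_nonneg)
      finally show ?thesis .
    qed
    moreover have "I n \<le> 5 * m n" by (simp add: m_def)
    ultimately have "cmod ((deriv ^^ 2) (\<phi> n) (1/2) / 2) \<le> 48 * (sqrt (m n) * (1 - ln (m n)))"
      using second_coeff_le[OF cont hol B left R m0 m1[OF that] _ _ vanish]
      by (simp add: I_def p_def)
    then have "dual_orlicz (cmod ((deriv ^^ 2) (\<phi> n) (1/2) / 2) / 48)
        \<le> dual_orlicz (sqrt (m n) * (1 - ln (m n)))"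
      by (intro dual_orlicz_mono) auto
    also have "\<dots> \<le> 16 * m n" using m0 m1[OF that] by (rule dual_orlicz_sqrt_log_le)
    finally show ?thesis .
  qed
  then have "(\<Sum>n<N. dual_orlicz (cmod ((deriv ^^ 2) (\<phi> n) (1/2) / 2) / 48)) \<le> (\<Sum>n<N. 16 * m n)"
    by (intro sum_mono) auto
  then show ?thesis using summ by (simp flip: sum_distrib_left)
qed simp

section \<open>Scalar estimates for elements of the Calderon space\<close>

lemma bdd_above_range_if_vanishing_at_infinity:
  fixes h :: "real \<Rightarrow> real"
  assumes "continuous_on UNIV h" "(h \<longlongrightarrow> 0) at_infinity"
  shows "bdd_above (range h)"
proof -
  have "\<forall>\<^sub>F t in at_infinity. dist (h t) 0 < 1" using assms(2) by (rule tendstoD) simp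
  then obtain b where b: "\<And>t. b \<le> norm t \<Longrightarrow> dist (h t) 0 < 1"
    unfolding eventually_at_infinity by auto
  have "bounded (h ` {-b..b})"
    by (intro compact_imp_bounded compact_continuous_image continuous_on_subset[OF assms(1)]) auto
  then obtain M where M: "\<And>t. t \<in> {-b..b} \<Longrightarrow> norm (h t) \<le> M" unfolding bounded_iff by blast
  have "h t \<le> max M 1" for t
    using M[of t] b[of t] by (cases "b \<le> norm t") (fastforce simp: dist_real_def abs_le_iff le_max_iff_disj)+
  then show ?thesis by (intro bdd_aboveI[of _ "max M 1"]) auto
qed

text \<open>The supremum in \<open>calderon_norm\<close> bounds its members only if they are bounded
  above. Boundedness in the sum space controls just the sup norm; for the \<open>ell_1\<close> norms
  the bound comes from continuity on compact intervals and decay at infinity.\<close>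

lemma boundary_condition_ell_1_bdd_above:
  assumes "boundary_condition ell_1 j F"
  shows "bdd_above (range (\<lambda>t. nrm ell_1 (F (Complex j t))))"
proof (rule bdd_above_range_if_vanishing_at_infinity)
  have el: "F (Complex j t) \<in> elems ell_1" for t
    using assms by (simp add: boundary_condition_def seq_continuous_on_def)
  have "((\<lambda>t. nrm ell_1 (F (Complex j t))) \<longlongrightarrow> nrm ell_1 (F (Complex j s))) (at s)" for s
  proof (rule LIM_zero_cancel, rule Lim_null_comparison)
    show "((\<lambda>t. nrm ell_1 (\<lambda>n. F (Complex j t) n - F (Complex j s) n)) \<longlongrightarrow> 0) (at s)"
      using assms by (simp add: boundary_condition_def seq_continuous_on_def seq_tendsto_def)
    show "\<forall>\<^sub>F t in at s. norm (nrm ell_1 (F (Complex j t)) - nrm ell_1 (F (Complex j s)))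
             \<le> nrm ell_1 (\<lambda>n. F (Complex j t) n - F (Complex j s) n)"
    proof (rule always_eventually, rule allI)
      fix t
      have "nrm ell_1 (\<lambda>n. F (Complex j s) n - F (Complex j t) n)
          = nrm ell_1 (\<lambda>n. F (Complex j t) n - F (Complex j s) n)"
        by (simp add: nrm_ell_1 norm_minus_commute)
      then show "norm (nrm ell_1 (F (Complex j t)) - nrm ell_1 (F (Complex j s)))
             \<le> nrm ell_1 (\<lambda>n. F (Complex j t) n - F (Complex j s) n)"
        using nrm_ell_1_le_add_diff[OF el el, of t s] nrm_ell_1_le_add_diff[OF el el, of s t]
        by (simp add: abs_le_iff)
    qed
  qed
  then show "continuous_on UNIV (\<lambda>t. nrm ell_1 (F (Complex j t)))"
    by (simp add: continuous_on_def)
  show "((\<lambda>t. nrm ell_1 (F (Complex j t))) \<longlongrightarrow> 0) at_infinity"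
    using assms by (simp add: boundary_condition_def seq_tendsto_def)
qed

lemma calderonD:
  assumes F: "F \<in> calderon ell_inf ell_1"
  shows "continuous_on strip (\<lambda>z. F z n)"
    and "\<exists>B. \<forall>z\<in>strip. \<forall>n. cmod (F z n) \<le> B"
    and "bounded_holomorphic_family open_strip F"
    and "cmod (F (Complex 0 t) n) \<le> calderon_norm ell_inf ell_1 F"
    and "(\<Sum>n<N. cmod (F (Complex 1 t) n)) \<le> calderon_norm ell_inf ell_1 F"
    and "0 \<le> calderon_norm ell_inf ell_1 F"
proof -
  have c: "seq_continuous_on ell_inf strip F"
    and b: "\<exists>B. \<forall>z\<in>strip. nrm (sum_space ell_inf ell_1) (F z) \<le> B"
    and a: "seq_analytic_on (sum_space ell_inf ell_1) open_strip F"
    and bc: "boundary_condition ell_inf 0 F" "boundary_condition ell_1 1 F"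
    using F by (auto simp: calderon_def seq_continuous_on_sum_space_iff)
  have el: "F z \<in> elems ell_inf" if "z \<in> strip" for z
    using c that by (simp add: seq_continuous_on_def)
  show "continuous_on strip (\<lambda>z. F z n)"
    using c by (auto simp: continuous_on_def seq_continuous_on_def intro: seq_tendsto_ell_infD)
  obtain B where B: "\<And>z. z \<in> strip \<Longrightarrow> nrm ell_inf (F z) \<le> B"
    using b el by (auto simp: nrm_sum_space_ell_inf_ell_1)
  have B': "cmod (F z n) \<le> B" if "z \<in> strip" for z n
    using cmod_le_nrm_ell_inf[OF el[OF that]] B[OF that] by (rule order_trans)
  then show "\<exists>B. \<forall>z\<in>strip. \<forall>n. cmod (F z n) \<le> B" by blast
  have sub: "open_strip \<subseteq> strip" by (auto simp: open_strip_def strip_def)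
  show "bounded_holomorphic_family open_strip F"
  proof (rule bounded_holomorphic_familyI[OF open_open_strip])
    show "(\<lambda>w. F w n) holomorphic_on open_strip" for n
      unfolding holomorphic_on_open[OF open_open_strip]
      using a by (auto simp: seq_analytic_on_def has_seq_deriv_sum_space_iff dest: has_seq_deriv_ell_infD)
  qed (use B' sub in blast)
  have "bdd_above (range (\<lambda>t. nrm ell_inf (F (Complex 0 t))))"
    using B by (auto simp: strip_def intro!: bdd_aboveI[of _ B])
  then have "nrm ell_inf (F (Complex 0 t)) \<le> calderon_norm ell_inf ell_1 F" for t
    unfolding calderon_norm_def by (intro max.coboundedI1 cSUP_upper) auto
  moreover have "cmod (F (Complex 0 t) n) \<le> nrm ell_inf (F (Complex 0 t))" for t n
    by (intro cmod_le_nrm_ell_inf el) (simp add: strip_def)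
  ultimately show *: "cmod (F (Complex 0 t) n) \<le> calderon_norm ell_inf ell_1 F" for t n
    by (meson order_trans)
  then show "0 \<le> calderon_norm ell_inf ell_1 F" by (meson norm_ge_zero order_trans)
  have el1: "F (Complex 1 t) \<in> elems ell_1"
    using bc(2) by (simp add: boundary_condition_def seq_continuous_on_def)
  have "(\<Sum>n<N. cmod (F (Complex 1 t) n)) \<le> nrm ell_1 (F (Complex 1 t))"
    using el1 by (auto simp: nrm_ell_1 elems_ell_1 intro!: sum_le_suminf)
  also have "\<dots> \<le> calderon_norm ell_inf ell_1 F"
    unfolding calderon_norm_def using boundary_condition_ell_1_bdd_above[OF bc(2)]
    by (intro max.coboundedI2 cSUP_upper) auto
  finally show "(\<Sum>n<N. cmod (F (Complex 1 t) n)) \<le> calderon_norm ell_inf ell_1 F" .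
qed

text \<open>\<open>768 = 48 * 16\<close>: the factor 48 is the scalar bound on the second
  coefficient, and 16 is the bound on the modular. A radius strictly above the norm permits
  normalising \<open>F\<close> even when its norm is 0.\<close>

lemma in_unit_ball_Delta_2:
  assumes F: "F \<in> ker_Delta ell_inf ell_1 k" and k: "k < 2" and r: "calderon_norm ell_inf ell_1 F < r"
  shows "in_unit_ball (\<lambda>n. Delta ell_inf ell_1 2 F n / of_real (768 * r))"
proof -
  have FC: "F \<in> calderon ell_inf ell_1" and F0: "\<And>n. Delta ell_inf ell_1 k F n = 0"
    using F by (auto simp: ker_Delta_def)
  note cal = calderonD[OF FC]
  have r0: "r > 0" using cal(6) r by linarith
  obtain B where B: "\<And>z n. z \<in> strip \<Longrightarrow> cmod (F z n) \<le> B" using cal(2) by blast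
  define \<phi> where "\<phi> = (\<lambda>n z. (1 / of_real r) * F z n)"
  have hol: "(\<lambda>z. F z n) holomorphic_on open_strip" for n
    using cal(3) by (simp add: bounded_holomorphic_family_def)
  have hd: "(deriv ^^ j) (\<phi> n) (1/2) = 1 / of_real r * (deriv ^^ j) (\<lambda>z. F z n) (1/2)" for j n
    unfolding \<phi>_def
    by (rule higher_deriv_cmult[OF hol _ open_open_strip]) (simp add: open_strip_def)
  have "(\<Sum>n<N. dual_orlicz (cmod ((deriv ^^ 2) (\<phi> n) (1/2) / 2) / 48)) \<le> 16" for N
  proof (rule sum_dual_orlicz_second_coeff_le)
    show "continuous_on strip (\<phi> n)" for n
      unfolding \<phi>_def by (intro continuous_intros cal(1))
    show "\<phi> n holomorphic_on open_strip" for n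
      unfolding \<phi>_def by (intro holomorphic_intros hol)
    show "cmod (\<phi> n z) \<le> B / r" if "z \<in> strip" for n z
      using B[OF that, of n] r0 by (simp add: \<phi>_def norm_mult norm_divide divide_right_mono)
    show "cmod (\<phi> n (Complex 0 t)) \<le> 1" for n t
      using cal(4)[of t n] r r0 by (simp add: \<phi>_def norm_mult norm_divide)
    show "(\<Sum>n<N. cmod (\<phi> n (Complex 1 t))) \<le> 1" for t
    proof -
      have "(\<Sum>n<N. cmod (\<phi> n (Complex 1 t))) = (\<Sum>n<N. cmod (F (Complex 1 t) n)) / r"
        using r0 by (simp add: \<phi>_def norm_mult norm_divide sum_divide_distrib)
      also have "\<dots> \<le> 1" using cal(5)[where N = N and t = t] r r0 by simp
      finally show ?thesis .
    qed
    show "\<phi> n (1/2) = 0 \<or> deriv (\<phi> n) (1/2) = 0" for n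
    proof -
      have "(deriv ^^ k) (\<phi> n) (1/2) = 0"
        using F0[of n] by (simp add: Delta_eq[OF cal(3)] hd)
      moreover have "k = 0 \<or> k = 1" using k by linarith
      ultimately show ?thesis by auto
    qed
  qed
  moreover have "cmod (Delta ell_inf ell_1 2 F n / of_real (48 * r))
      = cmod ((deriv ^^ 2) (\<phi> n) (1/2) / 2) / 48" for n
    using r0 by (simp add: Delta_eq[OF cal(3)] hd norm_mult norm_divide fact_2 mult_ac)
  ultimately have "(\<Sum>n<N. dual_orlicz (cmod (Delta ell_inf ell_1 2 F n / of_real (48 * r)))) \<le> 16" for N
    by presburger
  then have "in_unit_ball (\<lambda>n. Delta ell_inf ell_1 2 F n / of_real (48 * r) / of_real 16)"
    by (rule in_unit_ballI[of 16, rotated]) simp_all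
  then show ?thesis by (simp add: mult.commute)
qed

subsection \<open>Construction of extremal functions\<close>

text \<open>Coordinatewise continuity handles finitely many coordinates, and \<open>\<beta>\<close>
  makes the remaining ones uniformly small. A merely bounded majorant would not give continuity in
  the sup norm.\<close>

lemma seq_continuous_on_ell_infI:
  assumes cont: "\<And>n. continuous_on S (\<lambda>z. G z n)"
    and le: "\<And>z n. z \<in> S \<Longrightarrow> cmod (G z n) \<le> \<beta> n" and \<beta>: "\<beta> \<longlonglongrightarrow> 0"
  shows "seq_continuous_on ell_inf S G"
  unfolding seq_continuous_on_def
proof (intro ballI)
  fix z assume z: "z \<in> S"
  obtain K where K: "\<And>n. \<beta> n \<le> K"
    using Bseq_eq_bounded[of \<beta>] convergent_imp_Bseq[of \<beta>] \<beta>
    by (metis Bseq_def abs_le_iff convergentI real_norm_def)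
  have el: "G w \<in> elems ell_inf" if "w \<in> S" for w
    using le[OF that] K unfolding elems_ell_inf by (meson order_trans)
  have inS: "\<forall>\<^sub>F w in at z within S. w \<in> S"
    by (simp add: eventually_at_filter)
  have "seq_tendsto ell_inf G (G z) (at z within S)"
  proof (rule seq_tendsto_ell_infI)
    fix e :: real assume e: "e > 0"
    then obtain N where N: "\<And>n. n \<ge> N \<Longrightarrow> \<bar>\<beta> n\<bar> < e / 2"
      using LIMSEQ_D[OF \<beta>, of "e / 2"] by auto
    have "((\<lambda>w. G w n) \<longlongrightarrow> G z n) (at z within S)" for n
      using cont[of n] z by (simp add: continuous_on_def)
    then have "\<forall>\<^sub>F w in at z within S. \<forall>n\<in>{..<N}. dist (G w n) (G z n) < e"
      using e by (intro eventually_ball_finite ballI tendstoD) auto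
    with inS show "\<forall>\<^sub>F w in at z within S. \<forall>n. cmod (G w n - G z n) \<le> e"
    proof eventually_elim
      case (elim w)
      show ?case
      proof
        fix n
        show "cmod (G w n - G z n) \<le> e"
        proof (cases "n < N")
          case False
          then show ?thesis
            using N[of n] le[OF elim(1), of n] le[OF z, of n] norm_triangle_ineq4[of "G w n" "G z n"] by linarith
        qed (use elim in \<open>auto simp: dist_norm less_imp_le\<close>)
      qed
    qed
  qed (use el z inS in \<open>auto elim!: eventually_mono\<close>)
  then show "G z \<in> elems ell_inf \<and> seq_tendsto ell_inf G (G z) (at z within S)" using el z by blast
qed

lemma seq_continuous_on_ell_1I:
  assumes cont: "\<And>n. continuous_on S (\<lambda>z. G z n)"
    and le: "\<And>z n. z \<in> S \<Longrightarrow> cmod (G z n) \<le> \<beta> n" and \<beta>: "summable \<beta>"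
  shows "seq_continuous_on ell_1 S G"
  unfolding seq_continuous_on_def
proof (intro ballI)
  fix z assume z: "z \<in> S"
  have el: "G w \<in> elems ell_1" if "w \<in> S" for w
    unfolding elems_ell_1 using le[OF that] by (intro summable_comparison_test'[OF \<beta>]) auto
  have inS: "\<forall>\<^sub>F w in at z within S. w \<in> S"
    by (simp add: eventually_at_filter)
  have "((\<lambda>w. nrm ell_1 (\<lambda>n. G w n - G z n)) \<longlongrightarrow> 0) (at z within S)"
  \<comment> \<open>At an isolated point of \<open>S\<close> the filter is trivial and so is the
    limit; Tannery's theorem covers the nontrivial filter.\<close>
  proof (cases "at z within S = bot")
    case False
    have "((\<lambda>w. \<Sum>n. cmod (G w n - G z n)) \<longlongrightarrow> (\<Sum>n. 0)) (at z within S)"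
    proof (rule tannerys_theorem[where M = "\<lambda>n. 2 * \<beta> n", THEN conjunct2, THEN conjunct2])
      show "((\<lambda>w. cmod (G w n - G z n)) \<longlongrightarrow> 0) (at z within S)" for n
        using cont[of n] z by (intro tendsto_norm_zero LIM_zero) (simp add: continuous_on_def)
      show "eventually (\<lambda>(n, w). norm (cmod (G w n - G z n)) \<le> 2 * \<beta> n) (at_top \<times>\<^sub>F (at z within S))"
        unfolding eventually_prod_filter
      proof (intro exI conjI allI impI)
        show "eventually (\<lambda>n::nat. True) at_top" by simp
        show "\<forall>\<^sub>F w in at z within S. w \<in> S" by (rule inS)
        fix n w assume "w \<in> S"
        then show "case (n, w) of (n, w) \<Rightarrow> norm (cmod (G w n - G z n)) \<le> 2 * \<beta> n"
          using le[of w n] le[OF z, of n] norm_triangle_ineq4[of "G w n" "G z n"] by simp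
      qed
    qed (use \<beta> False in auto)
    then show ?thesis by (simp add: nrm_ell_1)
  qed simp
  then show "G z \<in> elems ell_1 \<and> seq_tendsto ell_1 G (G z) (at z within S)"
    using el z inS by (auto simp: seq_tendsto_def elim!: eventually_mono)
qed

lemma seq_tendsto_zeroI:
  assumes "\<And>t. g t \<in> elems X" "(\<lambda>n. 0) \<in> elems X" "\<And>t. 0 \<le> nrm X (g t)"
    and "\<And>t. nrm X (g t) \<le> c / (1 + \<bar>t\<bar>)"
  shows "seq_tendsto X g (\<lambda>n. 0) (at_infinity :: real filter)"
proof -
  have "((\<lambda>t::real. c / (1 + \<bar>t\<bar>)) \<longlongrightarrow> 0) at_infinity"
  proof (rule tendsto_divide_0[OF tendsto_const])
    have "filterlim (\<lambda>t::real. norm t + 1) at_top at_infinity"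
      by (intro filterlim_at_top_mono[OF filterlim_norm_at_top]) auto
    then show "filterlim (\<lambda>t::real. 1 + \<bar>t\<bar>) at_infinity at_infinity"
      by (intro filterlim_at_top_imp_at_infinity) (simp add: add.commute)
  qed
  then have "((\<lambda>t. nrm X (g t)) \<longlongrightarrow> 0) at_infinity"
    by (rule Lim_null_comparison[rotated]) (use assms in simp)
  then show ?thesis using assms by (simp add: seq_tendsto_def)
qed

text \<open>The factor \<open>exp (L n * z)\<close> has modulus 1 on the left line and
  \<open>exp (L n)\<close> on the right one. The linear factor offers two unknowns per coordinate,
  enough to prescribe the second coefficient at \<open>1/2\<close> and to annihilate one lower
  coefficient. The Gaussian enforces decay at infinity.\<close>

definition profile :: "(nat \<Rightarrow> real) \<Rightarrow> (nat \<Rightarrow> complex) \<Rightarrow> (nat \<Rightarrow> complex) \<Rightarrow> complex \<Rightarrow> nat \<Rightarrow> complex" where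
  "profile L a b z n = exp ((z - 1/2)\<^sup>2 + of_real (L n) * z) * (a n + b n * (z - 1/2))"

lemma norm_profile_le:
  assumes z: "z \<in> strip"
  shows "cmod (profile L a b z n) \<le> 4 / (1 + \<bar>Im z\<bar>) * ((cmod (a n) + cmod (b n)) * exp (L n * Re z))"
proof -
  let ?t = "\<bar>Im z\<bar>"
  have half: "\<bar>Re z - 1/2\<bar> \<le> 1/2" using z unfolding strip_def abs_le_iff by auto
  have "cmod (z - 1/2) \<le> \<bar>Re (z - 1/2)\<bar> + \<bar>Im (z - 1/2)\<bar>" by (rule cmod_le)
  also have "\<dots> \<le> 1 + ?t" using half by simp
  finally have "cmod (a n + b n * (z - 1/2)) \<le> cmod (a n) + cmod (b n) * (1 + ?t)"
    by (intro norm_triangle_le add_mono) (auto simp: norm_mult intro!: mult_left_mono)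
  also have "\<dots> \<le> (cmod (a n) + cmod (b n)) * (1 + ?t)" by (simp add: algebra_simps)
  finally have lin: "cmod (a n + b n * (z - 1/2)) \<le> (cmod (a n) + cmod (b n)) * (1 + ?t)" .
  have "0 \<le> (1 - ?t)\<^sup>2" by simp
  then have "(1 + ?t) * (1 + ?t) \<le> 2 * (1 + (Im z)\<^sup>2)" by (simp add: power2_eq_square algebra_simps)
  then have "2 * ((1 + ?t) * (1 + ?t)) \<le> 4 * (1 + (Im z)\<^sup>2)" by simp
  then have sq: "2 / (1 + (Im z)\<^sup>2) * (1 + ?t) \<le> 4 / (1 + ?t)"
    by (simp only: times_divide_eq_left mult.assoc) (simp add: divide_simps add_pos_nonneg add_nonneg_eq_0_iff algebra_simps)
  have "cmod (profile L a b z n)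
      = cmod (exp ((z - 1/2)\<^sup>2)) * cmod (a n + b n * (z - 1/2)) * exp (L n * Re z)"
    by (simp add: profile_def exp_add norm_mult)
  also have "\<dots> \<le> 2 / (1 + (Im z)\<^sup>2) * ((cmod (a n) + cmod (b n)) * (1 + ?t)) * exp (L n * Re z)"
    by (intro mult_right_mono mult_mono norm_exp_centered_square_le[OF z] lin)
      (auto simp: add_nonneg_nonneg)
  also have "\<dots> = 2 / (1 + (Im z)\<^sup>2) * (1 + ?t) * ((cmod (a n) + cmod (b n)) * exp (L n * Re z))"
    by (simp only: mult_ac)
  also have "\<dots> \<le> 4 / (1 + ?t) * ((cmod (a n) + cmod (b n)) * exp (L n * Re z))"
    by (intro mult_right_mono sq) (auto simp: add_nonneg_nonneg)
  finally show ?thesis .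
qed

text \<open>On the strip \<open>exp (L n * Re z)\<close> is at most 1, so a multiple of
  \<open>cmod (a n) + cmod (b n)\<close> dominates, and its convergence to 0 gives continuity into
  \<open>ell_inf\<close>. On the right line the weights \<open>exp (L n)\<close> make the majorant
  summable, which gives continuity into \<open>ell_1\<close>.\<close>

lemma profile_in_calderon:
  assumes L: "\<And>n. L n \<le> 0"
    and le: "\<And>n. cmod (a n) + cmod (b n) \<le> A" and lim: "(\<lambda>n. cmod (a n) + cmod (b n)) \<longlonglongrightarrow> 0"
    and sm: "summable (\<lambda>n. (cmod (a n) + cmod (b n)) * exp (L n))"
      "(\<Sum>n. (cmod (a n) + cmod (b n)) * exp (L n)) \<le> A"
  shows "profile L a b \<in> calderon ell_inf ell_1"
    and "calderon_norm ell_inf ell_1 (profile L a b) \<le> 4 * A"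
proof -
  let ?F = "profile L a b" and ?c = "\<lambda>n. cmod (a n) + cmod (b n)"
  have A: "A \<ge> 0" using le[of 0] norm_ge_zero[of "a 0"] norm_ge_zero[of "b 0"] by linarith
  have strip: "cmod (?F z n) \<le> 4 / (1 + \<bar>Im z\<bar>) * ?c n" if "z \<in> strip" for z n
  proof -
    have "L n * Re z \<le> 0" using that L[of n] unfolding strip_def by (intro mult_nonpos_nonneg) auto
    then have "?c n * exp (L n * Re z) \<le> ?c n * 1" by (intro mult_left_mono) auto
    then have "4 / (1 + \<bar>Im z\<bar>) * (?c n * exp (L n * Re z)) \<le> 4 / (1 + \<bar>Im z\<bar>) * (?c n * 1)"
      by (rule mult_left_mono) auto
    then show ?thesis using norm_profile_le[OF that, of L a b n] by simp
  qed
  have frac: "4 / (1 + \<bar>t\<bar>) \<le> 4" "0 \<le> 4 / (1 + \<bar>t\<bar>)" for t :: real by (auto simp: divide_le_eq)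
  have strip': "cmod (?F z n) \<le> 4 * ?c n" if "z \<in> strip" for z n
    using strip[OF that, of n] mult_right_mono[OF frac(1)[of "Im z"], of "?c n"]
    by (simp add: add_nonneg_nonneg)
  have "4 * ?c n \<le> 4 * A" for n using le[of n] by simp
  then have stripA: "cmod (?F z n) \<le> 4 * A" if "z \<in> strip" for z n
    using strip'[OF that] by (meson order_trans)
  have cont: "continuous_on S (\<lambda>z. ?F z n)" for n S
    unfolding profile_def by (intro continuous_intros)
  have lim4: "(\<lambda>n. 4 * ?c n) \<longlonglongrightarrow> 0" using tendsto_mult_left[OF lim, of 4] by simp
  have csum: "seq_continuous_on ell_inf strip ?F"
    by (rule seq_continuous_on_ell_infI[OF cont strip' lim4])
  have cont': "continuous_on UNIV (\<lambda>t. ?F (Complex j t) n)" for j n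
    unfolding profile_def Complex_eq by (intro continuous_intros)
  have inf: "\<And>t n. cmod (?F (Complex 0 t) n) \<le> 4 / (1 + \<bar>t\<bar>) * ?c n"
    using strip[of "Complex 0 t" for t] by (simp add: strip_def)
  have one: "\<And>t n. cmod (?F (Complex 1 t) n) \<le> 4 / (1 + \<bar>t\<bar>) * (?c n * exp (L n))"
    using norm_profile_le[of "Complex 1 t" L a b for t] by (simp add: strip_def)
  have el_inf: "?F (Complex 0 t) \<in> elems ell_inf" for t
    using stripA[of "Complex 0 t"] by (auto simp: strip_def elems_ell_inf)
  have el_1: "?F (Complex 1 t) \<in> elems ell_1" for t
    unfolding elems_ell_1 using one[of t]
    by (intro summable_comparison_test'[OF summable_mult[OF sm(1), of "4 / (1 + \<bar>t\<bar>)"]]) simp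
  have n_inf: "nrm ell_inf (?F (Complex 0 t)) \<le> 4 * A / (1 + \<bar>t\<bar>)" for t
  proof (rule nrm_ell_inf_le)
    fix n
    have "4 / (1 + \<bar>t\<bar>) * ?c n \<le> 4 / (1 + \<bar>t\<bar>) * A" by (intro mult_left_mono le frac)
    then show "cmod (?F (Complex 0 t) n) \<le> 4 * A / (1 + \<bar>t\<bar>)" using inf[of t n] by simp
  qed
  have n_1: "nrm ell_1 (?F (Complex 1 t)) \<le> 4 * A / (1 + \<bar>t\<bar>)" for t
  proof -
    have "(\<Sum>n. cmod (?F (Complex 1 t) n)) \<le> (\<Sum>n. 4 / (1 + \<bar>t\<bar>) * (?c n * exp (L n)))"
      using el_1[of t] by (intro suminf_le one summable_mult sm(1)) (simp add: elems_ell_1)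
    also have "\<dots> = 4 / (1 + \<bar>t\<bar>) * (\<Sum>n. ?c n * exp (L n))" by (rule suminf_mult[OF sm(1)])
    also have "\<dots> \<le> 4 / (1 + \<bar>t\<bar>) * A" by (intro mult_left_mono sm(2) frac)
    finally show ?thesis by (simp add: nrm_ell_1)
  qed
  have sub: "open_strip \<subseteq> strip" by (auto simp: open_strip_def strip_def)
  have "bounded_holomorphic_family open_strip ?F"
  proof (rule bounded_holomorphic_familyI[OF open_open_strip])
    show "(\<lambda>w. ?F w n) holomorphic_on open_strip" for n
      unfolding profile_def by (intro holomorphic_intros)
  qed (use stripA sub in blast)
  then have an: "seq_analytic_on (sum_space ell_inf ell_1) open_strip ?F"
    unfolding seq_analytic_on_def has_seq_deriv_sum_space_iff
    using bounded_holomorphic_family_has_seq_deriv open_open_strip by blast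
  have "nrm (sum_space ell_inf ell_1) (?F z) \<le> 4 * A" if "z \<in> strip" for z
    using stripA[OF that] csum that
    by (subst nrm_sum_space_ell_inf_ell_1) (auto simp: seq_continuous_on_def intro!: nrm_ell_inf_le)
  moreover have "boundary_condition ell_inf 0 ?F"
    unfolding boundary_condition_def
  proof
    show "seq_continuous_on ell_inf UNIV (\<lambda>t. ?F (Complex 0 t))"
      using strip'[of "Complex 0 t" for t]
      by (intro seq_continuous_on_ell_infI[OF cont' _ lim4]) (simp add: strip_def)
    show "seq_tendsto ell_inf (\<lambda>t. ?F (Complex 0 t)) (\<lambda>n. 0) at_infinity"
      by (rule seq_tendsto_zeroI[OF el_inf _ nrm_ell_inf_nonneg[OF el_inf] n_inf]) (auto simp: elems_ell_inf)
  qed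
  moreover have "boundary_condition ell_1 1 ?F"
    unfolding boundary_condition_def
  proof
    show "seq_continuous_on ell_1 UNIV (\<lambda>t. ?F (Complex 1 t))"
    proof (rule seq_continuous_on_ell_1I[OF cont'])
      fix t n
      have "4 / (1 + \<bar>t\<bar>) * (?c n * exp (L n)) \<le> 4 * (?c n * exp (L n))"
        by (intro mult_right_mono frac) (auto simp: add_nonneg_nonneg)
      then show "cmod (?F (Complex 1 t) n) \<le> 4 * (?c n * exp (L n))" using one[of t n] by linarith
    qed (intro summable_mult sm(1))
    show "seq_tendsto ell_1 (\<lambda>t. ?F (Complex 1 t)) (\<lambda>n. 0) at_infinity"
      by (rule seq_tendsto_zeroI[OF el_1 _ nrm_ell_1_nonneg[OF el_1] n_1]) (auto simp: elems_ell_1)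
  qed
  ultimately show "?F \<in> calderon ell_inf ell_1"
    using csum an by (auto simp: calderon_def seq_continuous_on_sum_space_iff)
  have "4 * A / (1 + \<bar>t\<bar>) \<le> 4 * A" for t :: real using A by (simp add: divide_le_eq mult_le_cancel_left1)
  then show "calderon_norm ell_inf ell_1 ?F \<le> 4 * A"
    unfolding calderon_norm_def using n_inf n_1
    by (intro max.boundedI cSUP_least) (auto intro: order_trans)
qed

lemma deriv_profile:
  shows "profile L a b (1/2) n = exp (of_real (L n) / 2) * a n"
    and "deriv (\<lambda>z. profile L a b z n) (1/2) = exp (of_real (L n) / 2) * (of_real (L n) * a n + b n)"
    and "(deriv ^^ 2) (\<lambda>z. profile L a b z n) (1/2)
      = exp (of_real (L n) / 2) * ((2 + (of_real (L n))\<^sup>2) * a n + 2 * of_real (L n) * b n)"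
proof -
  show "profile L a b (1/2) n = exp (of_real (L n) / 2) * a n" by (simp add: profile_def)
  let ?e = "\<lambda>z. exp ((z - 1/2)\<^sup>2 + of_real (L n) * z)"
  have "deriv (\<lambda>z. profile L a b z n) z
      = ?e z * ((2 * (z - 1/2) + of_real (L n)) * (a n + b n * (z - 1/2)) + b n)" for z
    unfolding profile_def
    by (rule DERIV_imp_deriv) (auto intro!: derivative_eq_intros simp: field_simps)
  then have d: "deriv (\<lambda>z. profile L a b z n)
      = (\<lambda>z. ?e z * ((2 * (z - 1/2) + of_real (L n)) * (a n + b n * (z - 1/2)) + b n))" by blast
  show "deriv (\<lambda>z. profile L a b z n) (1/2) = exp (of_real (L n) / 2) * (of_real (L n) * a n + b n)"
    unfolding d by simp
  have "deriv (deriv (\<lambda>z. profile L a b z n)) (1/2)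
      = exp (of_real (L n) / 2) * ((2 + (of_real (L n))\<^sup>2) * a n + 2 * of_real (L n) * b n)"
    unfolding d
    by (rule DERIV_imp_deriv) (auto intro!: derivative_eq_intros simp: algebra_simps power2_eq_square)
  then show "(deriv ^^ 2) (\<lambda>z. profile L a b z n) (1/2)
      = exp (of_real (L n) / 2) * ((2 + (of_real (L n))\<^sup>2) * a n + 2 * of_real (L n) * b n)"
    by (simp add: numeral_2_eq_2)
qed

text \<open>A form of Dini's theorem on series divided by powers of their tails: each quotient is at
  most \<open>2 * (sqrt (T n) - sqrt (T (Suc n)))\<close>, and these bounds telescope. The tail
  \<open>T n\<close> includes the term \<open>\<nu> n\<close>, so it dominates that term.\<close>

lemma sum_divide_sqrt_tail_le:
  fixes \<nu> :: "nat \<Rightarrow> real"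
  assumes \<nu>: "\<And>n. 0 \<le> \<nu> n" and sm: "summable \<nu>"
    and T_def: "\<And>n. T n = suminf \<nu> - (\<Sum>k<n. \<nu> k)"
  shows "\<nu> n \<le> T n" "T \<longlonglongrightarrow> 0" "summable (\<lambda>n. \<nu> n / sqrt (T n))"
    "(\<Sum>n. \<nu> n / sqrt (T n)) \<le> 2 * sqrt (suminf \<nu>)"
proof -
  have T0: "T n \<ge> 0" for n
    unfolding T_def using sum_le_suminf[OF sm, of "{..<n}"] \<nu> by simp
  have TS: "T (Suc n) = T n - \<nu> n" for n by (simp add: T_def)
  show le: "\<nu> n \<le> T n" for n using T0[of "Suc n"] by (simp add: TS)
  have "(\<lambda>n. suminf \<nu> - (\<Sum>k<n. \<nu> k)) \<longlonglongrightarrow> suminf \<nu> - suminf \<nu>"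
    by (intro tendsto_intros summable_LIMSEQ sm)
  then show "T \<longlonglongrightarrow> 0" by (simp add: T_def[abs_def])
  have step: "\<nu> n / sqrt (T n) \<le> 2 * (sqrt (T n) - sqrt (T (Suc n)))" for n
  proof (cases "T n = 0")
    \<comment> \<open>The quotient is 0 here, division by zero being 0.\<close>
    case True
    then show ?thesis using T0[of "Suc n"] \<nu>[of n] by (simp add: TS)
  next
    case False
    then have pos: "sqrt (T n) > 0" using T0[of n] by simp
    have mono: "sqrt (T (Suc n)) \<le> sqrt (T n)" using \<nu>[of n] by (simp add: TS)
    have "\<nu> n = (sqrt (T n))\<^sup>2 - (sqrt (T (Suc n)))\<^sup>2"
      using T0[of n] T0[of "Suc n"] by (simp only: real_sqrt_pow2) (simp add: TS)
    also have "\<dots> = (sqrt (T n) - sqrt (T (Suc n))) * (sqrt (T n) + sqrt (T (Suc n)))"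
      by (simp add: power2_eq_square algebra_simps)
    also have "\<dots> \<le> (sqrt (T n) - sqrt (T (Suc n))) * (2 * sqrt (T n))"
      using mono by (intro mult_left_mono) auto
    finally show ?thesis using pos by (simp add: divide_le_eq mult_ac)
  qed
  have "(\<Sum>n<N. \<nu> n / sqrt (T n)) \<le> 2 * (sqrt (T 0) - sqrt (T N))" for N
  proof (induction N)
    case (Suc N)
    then show ?case using step[of N] by simp
  qed simp
  then have bd: "(\<Sum>n<N. \<nu> n / sqrt (T n)) \<le> 2 * sqrt (suminf \<nu>)" for N
    using real_sqrt_ge_zero[OF T0[of N]] by (force simp: T_def[of 0] intro: order_trans)
  show *: "summable (\<lambda>n. \<nu> n / sqrt (T n))"
    using bd[of "Suc N" for N] \<nu> T0
    by (intro bounded_imp_summable[of _ "2 * sqrt (suminf \<nu>)"])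
      (auto simp: lessThan_Suc_atMost simp del: sum.lessThan_Suc)
  show "(\<Sum>n. \<nu> n / sqrt (T n)) \<le> 2 * sqrt (suminf \<nu>)"
    by (rule suminf_le_const[OF * bd])
qed

text \<open>
  The weights \<open>exp (L n)\<close> are \<open>dual_orlicz (cmod (v n))\<close> divided by the square root of its tail sum.
  This division keeps their sum finite and makes the coefficients \<open>\<gamma> n\<close> tend to \<open>0\<close>, without
  which the resulting functions would not be continuous into \<open>ell_inf\<close>.
\<close>

lemma unit_ball_exponents:
  assumes v: "in_unit_ball v"
  obtains L :: "nat \<Rightarrow> real" and \<gamma> :: "nat \<Rightarrow> real" where
    "\<And>n. L n \<le> - 4" "\<And>n. cmod (v n) \<le> \<gamma> n * exp (L n / 2) * \<bar>L n\<bar>" "\<And>n. 0 \<le> \<gamma> n" "\<And>n. \<gamma> n \<le> exp 2"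
    "\<gamma> \<longlonglongrightarrow> 0" "summable (\<lambda>n. \<gamma> n * exp (L n))" "(\<Sum>n. \<gamma> n * exp (L n)) \<le> exp 2"
proof -
  define \<nu> where "\<nu> = (\<lambda>n. dual_orlicz (cmod (v n)))"
  have \<nu>0: "\<nu> n \<ge> 0" for n by (simp add: \<nu>_def dual_orlicz_nonneg)
  have sm: "summable \<nu>" and S: "suminf \<nu> \<le> 1" using v by (auto simp: \<nu>_def)
  define T where "T = (\<lambda>n. suminf \<nu> - (\<Sum>k<n. \<nu> k))"
  note tail = sum_divide_sqrt_tail_le[OF \<nu>0 sm fun_cong[OF T_def]]
  have T0: "T n \<ge> 0" for n using tail(1)[of n] \<nu>0[of n] by linarith
  have T1: "T n \<le> 1" for n
    unfolding T_def using S sum_nonneg[of "{..<n}" \<nu>] \<nu>0 by simp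
  have \<nu>1: "\<nu> n \<le> 1" for n using tail(1)[of n] T1[of n] by linarith
  \<comment> \<open>The factor \<open>exp (- 4)\<close> forces \<open>L n \<le> - 4\<close>, which
    keeps \<open>1 - (L n)^2 / 2\<close> away from 0 when the coefficients are solved for. At zero
    entries \<open>- 4\<close> is just an admissible value.\<close>
  define L where "L = (\<lambda>n. if v n = 0 then - 4 else ln (exp (- 4) * (\<nu> n / sqrt (T n))))"
  \<comment> \<open>The fourth root of \<open>T n\<close> and the factor \<open>exp 2\<close> undo
    the normalisation of \<open>L\<close>: for a nonzero entry,
    \<open>\<gamma> n * exp (L n / 2)\<close> is the square root of \<open>\<nu> n\<close>, that is,
    \<open>cmod (v n)\<close> divided by its weight.\<close>
  define \<gamma> where "\<gamma> = (\<lambda>n. if v n = 0 then 0 else exp 2 * sqrt (sqrt (T n)))"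
  have main: "exp (L n) = exp (- 4) * (\<nu> n / sqrt (T n))" "L n \<le> - 4" "log_weight (cmod (v n)) \<le> \<bar>L n\<bar>"
    "cmod (v n) = exp 2 * sqrt (sqrt (T n)) * exp (L n / 2) * log_weight (cmod (v n))" if "v n \<noteq> 0" for n
  proof -
    define t where "t = cmod (v n)"
    define M where "M = log_weight t"
    have t: "0 < t" using that by (simp add: t_def)
    have t1: "t \<le> 1" using dual_orlicz_le_1_imp[of t] \<nu>1[of n] t by (simp add: \<nu>_def t_def)
    have M: "M = 1 - ln t" "M \<ge> 1"
      using log_weight_le_1[OF t t1] log_weight_ge_1[of t] by (auto simp: M_def)
    have \<nu>t: "\<nu> n = (t / M)\<^sup>2" by (simp add: \<nu>_def dual_orlicz_def t_def M_def)
    then have sq\<nu>: "sqrt (\<nu> n) = t / M" using t M(2) by simp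
    have \<nu>pos: "\<nu> n > 0" using t M(2) by (simp add: \<nu>t)
    have Tpos: "T n > 0" using tail(1)[of n] \<nu>pos by linarith
    have Leq: "L n = ln (exp (- 4) * (\<nu> n / sqrt (T n)))" using that by (simp add: L_def)
    show eL: "exp (L n) = exp (- 4) * (\<nu> n / sqrt (T n))"
      using \<nu>pos Tpos by (simp add: Leq)
    \<comment> \<open>As \<open>T n\<close> dominates \<open>\<nu> n\<close>, dividing by its square
      root costs at most a square root of \<open>\<nu> n\<close>. Hence \<open>exp (L n)\<close> is
      at most \<open>exp (- 4) * t / M\<close>, and \<open>\<bar>L n\<bar>\<close> dominates the
      weight \<open>M\<close>.\<close>
    have "\<nu> n / sqrt (T n) \<le> \<nu> n / sqrt (\<nu> n)"
      using \<nu>pos Tpos tail(1)[of n] by (intro divide_left_mono) auto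
    also have "\<dots> = t / M" unfolding sq\<nu>[symmetric] by (rule real_div_sqrt[OF less_imp_le[OF \<nu>pos]])
    finally have "ln (\<nu> n / sqrt (T n)) \<le> ln (t / M)" using \<nu>pos Tpos by (intro ln_mono) auto
    moreover have "L n = - 4 + ln (\<nu> n / sqrt (T n))"
      unfolding Leq using \<nu>pos Tpos by (subst ln_mult) auto
    ultimately have "L n \<le> - 4 + ln (t / M)" by simp
    also have "ln (t / M) = ln t - ln M" using t M(2) by (simp add: ln_div)
    also have "ln t = 1 - M" using M(1) by simp
    finally have LM: "L n \<le> - 3 - M" using M by (smt (verit) ln_ge_zero)
    then show "L n \<le> - 4" "log_weight (cmod (v n)) \<le> \<bar>L n\<bar>" using M by (auto simp: M_def t_def)
    have e2: "exp (L n / 2) = sqrt (exp (L n))"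
      by (rule real_sqrt_unique[symmetric]) (auto simp: power2_eq_square simp flip: exp_add)
    have e4: "sqrt (exp (- 4)) = exp (- 2 :: real)"
      by (rule real_sqrt_unique) (auto simp: power2_eq_square simp flip: exp_add)
    have "exp (L n / 2) = exp (- 2) * ((t / M) / sqrt (sqrt (T n)))"
      by (simp add: e2 eL real_sqrt_mult real_sqrt_divide sq\<nu> e4)
    then have "exp 2 * sqrt (sqrt (T n)) * exp (L n / 2) = t / M"
      using Tpos by (simp add: exp_minus field_simps)
    then show "cmod (v n) = exp 2 * sqrt (sqrt (T n)) * exp (L n / 2) * log_weight (cmod (v n))"
      using M by (simp add: t_def[symmetric] M_def[symmetric])
  qed
  have sqT: "sqrt (sqrt (T n)) \<le> 1" "0 \<le> sqrt (sqrt (T n))" for n using T0[of n] T1[of n] by auto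
  have \<gamma>L: "\<gamma> n * exp (L n) \<le> exp (- 2) * (\<nu> n / sqrt (T n))" for n
  proof (cases "v n = 0")
    case False
    have "\<gamma> n * exp (L n) \<le> exp 2 * 1 * exp (L n)"
      unfolding \<gamma>_def using False sqT[of n] by (simp del: exp_le_cancel_iff)
    also have "\<dots> = exp 2 * exp (- 4) * (\<nu> n / sqrt (T n))" by (simp add: main(1)[OF False])
    also have "exp 2 * exp (- 4) = exp (- 2 :: real)" by (simp flip: exp_add)
    finally show ?thesis .
  qed (simp add: \<gamma>_def \<nu>0 T0)
  have \<gamma>0: "\<gamma> n \<ge> 0" for n using sqT(2)[of n] by (simp add: \<gamma>_def)
  show thesis
  proof (rule that[of L \<gamma>])
    show "L n \<le> - 4" for n using main(2)[of n] by (cases "v n = 0") (auto simp: L_def)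
    show "cmod (v n) \<le> \<gamma> n * exp (L n / 2) * \<bar>L n\<bar>" for n
    proof (cases "v n = 0")
      case False
      then show ?thesis
        by (subst main(4)[OF False])
          (auto simp: \<gamma>_def T0 intro!: mult_left_mono main(3)[OF False] mult_nonneg_nonneg)
    qed (simp add: \<gamma>_def)
    show "\<gamma> n \<le> exp 2" for n using sqT[of n] by (simp add: \<gamma>_def)
    have "(\<lambda>n. exp 2 * sqrt (sqrt (T n))) \<longlonglongrightarrow> exp 2 * sqrt (sqrt 0)"
      by (intro tendsto_intros tail(2))
    then have "(\<lambda>n. exp 2 * sqrt (sqrt (T n))) \<longlonglongrightarrow> 0" by simp
    then show "\<gamma> \<longlonglongrightarrow> 0"
      by (rule Lim_null_comparison[rotated]) (auto simp: \<gamma>_def T0)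
    show sm\<gamma>: "summable (\<lambda>n. \<gamma> n * exp (L n))"
      using \<gamma>L \<gamma>0 by (intro summable_comparison_test'[OF summable_mult[OF tail(3), of "exp (- 2)"]]) simp
    have "(\<Sum>n. \<gamma> n * exp (L n)) \<le> (\<Sum>n. exp (- 2) * (\<nu> n / sqrt (T n)))"
      by (intro suminf_le \<gamma>L sm\<gamma> summable_mult tail(3))
    also have "\<dots> = exp (- 2) * (\<Sum>n. \<nu> n / sqrt (T n))" by (intro suminf_mult tail(3))
    also have "\<dots> \<le> exp (- 2) * 2"
    proof (intro mult_left_mono order_trans[OF tail(4)])
      show "2 * sqrt (suminf \<nu>) \<le> 2" using S by simp
    qed simp
    also have "\<dots> \<le> 1 * 2" by (intro mult_right_mono) auto
    also have "\<dots> \<le> exp 2" using exp_ge_add_one_self[of 2] by simp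
    finally show "(\<Sum>n. \<gamma> n * exp (L n)) \<le> exp 2" .
  qed (rule \<gamma>0)
qed

lemma exists_in_ker_Delta:
  assumes k: "k < 2" and r: "r > 0" and w: "in_unit_ball (\<lambda>n. w n / of_real r)"
  shows "\<exists>F\<in>ker_Delta ell_inf ell_1 k. Delta ell_inf ell_1 2 F = w \<and>
           calderon_norm ell_inf ell_1 F \<le> 32 * exp 2 * r"
proof -
  obtain L \<gamma> where L: "\<And>n. L n \<le> - 4"
    and v: "\<And>n. cmod (w n / of_real r) \<le> \<gamma> n * exp (L n / 2) * \<bar>L n\<bar>"
    and \<gamma>: "\<And>n. 0 \<le> \<gamma> n" "\<And>n. \<gamma> n \<le> exp 2" "\<gamma> \<longlonglongrightarrow> 0"
      "summable (\<lambda>n. \<gamma> n * exp (L n))" "(\<Sum>n. \<gamma> n * exp (L n)) \<le> exp 2"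
    by (rule unit_ball_exponents[OF w]) (rule that)
  \<comment> \<open>Normalised solutions of two linear equations: second Taylor coefficient 1,
    coefficient of order \<open>k\<close> equal to 0. For \<open>k = 0\<close> the constant term
    vanishes and \<open>q = 1 / l\<close>; for \<open>k = 1\<close> one has
    \<open>q = - l * p\<close>, leaving \<open>(1 - l^2 / 2) * p = 1\<close>. Both are of size
    \<open>1 / \<bar>l\<bar>\<close>, which is the logarithmic gain.\<close>
  obtain p q :: "real \<Rightarrow> real" where
    pq_le: "\<And>l. l \<le> - 4 \<Longrightarrow> \<bar>p l\<bar> + \<bar>q l\<bar> \<le> 8 / \<bar>l\<bar>"
    and pq: "\<And>l. l \<le> - 4 \<Longrightarrow> (1 + l\<^sup>2 / 2) * p l + l * q l = 1"
    and pqk: "\<And>l. l \<le> - 4 \<Longrightarrow> (if k = 0 then p l else l * p l + q l) = 0"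
  proof (cases "k = 0")
    case True
    show thesis
      by (rule that[of "\<lambda>l. 0" "\<lambda>l. 1 / l"]) (auto simp: True divide_right_mono_neg)
  next
    case False
    have sq: "l\<^sup>2 / 2 - 1 \<ge> l\<^sup>2 / 4" "l\<^sup>2 \<ge> 16" if "l \<le> - 4" for l :: real
      using power_mono[of 4 "- l" 2] that by auto
    show thesis
    proof (rule that[of "\<lambda>l. 1 / (1 - l\<^sup>2 / 2)" "\<lambda>l. - l / (1 - l\<^sup>2 / 2)"])
      fix l :: real assume l: "l \<le> - 4"
      note sq = sq[OF l]
      have "\<bar>1 / (1 - l\<^sup>2 / 2)\<bar> + \<bar>- l / (1 - l\<^sup>2 / 2)\<bar> = (1 + \<bar>l\<bar>) / (l\<^sup>2 / 2 - 1)"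
        using sq by (simp add: abs_of_nonpos add_divide_distrib)
      also have "\<dots> \<le> (2 * \<bar>l\<bar>) / (l\<^sup>2 / 4)" using sq l by (intro frac_le) auto
      also have "\<dots> = 8 / \<bar>l\<bar>" using l by (simp add: power2_eq_square field_simps)
      finally show "\<bar>1 / (1 - l\<^sup>2 / 2)\<bar> + \<bar>- l / (1 - l\<^sup>2 / 2)\<bar> \<le> 8 / \<bar>l\<bar>" .
      show "(1 + l\<^sup>2 / 2) * (1 / (1 - l\<^sup>2 / 2)) + l * (- l / (1 - l\<^sup>2 / 2)) = 1"
        using sq by (simp add: divide_simps) (simp add: power2_eq_square algebra_simps)
    qed (auto simp: False)
  qed
  define y where "y = (\<lambda>n. w n / exp (of_real (L n) / 2))"
  define a b where "a = (\<lambda>n. of_real (p (L n)) * y n)" and "b = (\<lambda>n. of_real (q (L n)) * y n)"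
  have ab: "cmod (a n) + cmod (b n) \<le> 8 * r * \<gamma> n" for n
  proof -
    have "cmod (y n) = r * cmod (w n / of_real r) / exp (L n / 2)"
      using r by (simp add: y_def norm_divide)
    also have "\<dots> \<le> r * (\<gamma> n * exp (L n / 2) * \<bar>L n\<bar>) / exp (L n / 2)"
      using r by (intro divide_right_mono mult_left_mono v) auto
    finally have y: "cmod (y n) \<le> r * \<gamma> n * \<bar>L n\<bar>" by (simp add: mult_ac)
    have "cmod (a n) + cmod (b n) = (\<bar>p (L n)\<bar> + \<bar>q (L n)\<bar>) * cmod (y n)"
      by (simp add: a_def b_def norm_mult algebra_simps)
    also have "\<dots> \<le> (8 / \<bar>L n\<bar>) * (r * \<gamma> n * \<bar>L n\<bar>)"
      by (intro mult_mono pq_le L y) auto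
    also have "\<dots> = 8 * r * \<gamma> n" using L[of n] by simp
    finally show ?thesis .
  qed
  have ab_exp: "(cmod (a n) + cmod (b n)) * exp (L n) \<le> 8 * r * (\<gamma> n * exp (L n))" for n
    using mult_right_mono[OF ab[of n], of "exp (L n)"] by (simp add: mult_ac)
  have "(cmod (a n) + cmod (b n)) \<le> 8 * exp 2 * r" for n
  proof -
    have "8 * r * \<gamma> n \<le> 8 * r * exp 2" using r by (intro mult_left_mono \<gamma>(2)) auto
    then show ?thesis using ab[of n] by (simp add: mult_ac)
  qed
  moreover have "(\<lambda>n. cmod (a n) + cmod (b n)) \<longlonglongrightarrow> 0"
  proof (rule Lim_null_comparison)
    show "(\<lambda>n. 8 * r * \<gamma> n) \<longlonglongrightarrow> 0" using tendsto_mult_left[OF \<gamma>(3), of "8 * r"] by simp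
  qed (use ab in \<open>simp add: add_nonneg_nonneg\<close>)
  moreover have sm: "summable (\<lambda>n. (cmod (a n) + cmod (b n)) * exp (L n))"
    using ab_exp
    by (intro summable_comparison_test'[OF summable_mult[OF \<gamma>(4), of "8 * r"]]) (simp add: add_nonneg_nonneg)
  moreover have "(\<Sum>n. (cmod (a n) + cmod (b n)) * exp (L n)) \<le> 8 * exp 2 * r"
  proof -
    have "(\<Sum>n. (cmod (a n) + cmod (b n)) * exp (L n)) \<le> (\<Sum>n. 8 * r * (\<gamma> n * exp (L n)))"
      by (intro suminf_le ab_exp sm summable_mult \<gamma>(4))
    also have "\<dots> = 8 * r * (\<Sum>n. \<gamma> n * exp (L n))" by (intro suminf_mult \<gamma>(4))
    also have "\<dots> \<le> 8 * r * exp 2" using r by (intro mult_left_mono \<gamma>(5)) auto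
    finally show ?thesis by (simp add: mult_ac)
  qed
  moreover have L0: "L n \<le> 0" for n using L[of n] by linarith
  ultimately have F: "profile L a b \<in> calderon ell_inf ell_1"
    "calderon_norm ell_inf ell_1 (profile L a b) \<le> 4 * (8 * exp 2 * r)"
    using profile_in_calderon[of L a b "8 * exp 2 * r"] by blast+
  note D = Delta_eq[OF calderonD(3)[OF F(1)]]
  have "Delta ell_inf ell_1 2 (profile L a b) n = w n" for n
  proof -
    have "Delta ell_inf ell_1 2 (profile L a b) n
        = exp (of_real (L n) / 2) * ((2 + (of_real (L n))\<^sup>2) * a n + 2 * of_real (L n) * b n) / 2"
      by (simp only: D deriv_profile(3)) (simp add: fact_2)
    also have "\<dots> = exp (of_real (L n) / 2) * y n * of_real ((1 + (L n)\<^sup>2 / 2) * p (L n) + L n * q (L n))"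
      by (simp add: a_def b_def field_simps)
    finally show ?thesis by (simp only: pq[OF L]) (simp add: y_def)
  qed
  moreover have "Delta ell_inf ell_1 k (profile L a b) n = 0" for n
  proof (cases "k = 0")
    case True
    then have "a n = 0" using pqk[OF L[of n]] by (simp add: a_def)
    then show ?thesis by (simp add: True D deriv_profile(1))
  next
    case False
    then have "k = 1" using k by simp
    have "of_real (L n) * a n + b n = y n * of_real (L n * p (L n) + q (L n))"
      by (simp add: a_def b_def algebra_simps)
    also have "\<dots> = 0" using pqk[OF L[of n]] False by simp
    finally show ?thesis by (simp add: \<open>k = 1\<close> D deriv_profile(2))
  qed
  ultimately show ?thesis using F
    by (intro bexI[of _ "profile L a b"]) (auto simp: ker_Delta_def mult_ac)
qed

text \<open>One constant serves both directions: 768 comes from the upper estimate and exceeds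
  \<open>32 * exp 2\<close>, because \<open>exp 2 \<le> 9\<close>.\<close>

lemma image_space_Delta_2_eq:
  assumes k: "k < 2"
  shows "image_space ell_inf ell_1 (Delta ell_inf ell_1 2) (ker_Delta ell_inf ell_1 k)
           \<cong>\<^sub>s orlicz_space dual_orlicz"
proof -
  let ?K = "ker_Delta ell_inf ell_1 k" and ?T = "Delta ell_inf ell_1 2"
  let ?N = "\<lambda>x. {calderon_norm ell_inf ell_1 F | F. F \<in> ?K \<and> ?T F = x}"
  let ?X = "image_space ell_inf ell_1 ?T ?K"
  have nrm: "nrm ?X x = Inf (?N x)" and el: "elems ?X = ?T ` ?K" for x
    by (simp_all add: image_space_def)
  have K0: "0 \<le> calderon_norm ell_inf ell_1 F" if "F \<in> ?K" for F
    using that calderonD(6) by (auto simp: ker_Delta_def)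
  have ne: "?N x \<noteq> {}" if "x \<in> elems ?X" for x using that by (auto simp: el)
  have bdd: "bdd_below (?N x)" for x by (rule bdd_belowI[of _ 0]) (auto dest: K0)
  show ?thesis
  proof (rule seq_space_eq_orlicz_dualI[of 768])
    fix x and r :: real assume x: "x \<in> elems ?X" and "768 * nrm ?X x < r"
    then have "Inf (?N x) < r / 768" by (simp add: nrm)
    then obtain F where "F \<in> ?K" "?T F = x" "calderon_norm ell_inf ell_1 F < r / 768"
      using cInf_lessD[OF ne[OF x]] by blast
    then show "in_unit_ball (\<lambda>n. x n / of_real r)"
      using in_unit_ball_Delta_2[OF _ k, of F "r / 768"] by auto
  next
    fix x and r :: real assume "r > 0" "in_unit_ball (\<lambda>n. x n / of_real r)"
    from exists_in_ker_Delta[OF k this] obtain F where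
      F: "F \<in> ?K" "?T F = x" "calderon_norm ell_inf ell_1 F \<le> 32 * exp 2 * r" by blast
    have "Inf (?N x) \<le> calderon_norm ell_inf ell_1 F"
      using F by (intro cInf_lower bdd) auto
    also have "\<dots> \<le> 768 * r"
    proof (rule order_trans[OF F(3)])
      have "exp (1::real) * exp 1 \<le> 3 * 3" using exp_le by (intro mult_mono) auto
      then have "exp (2::real) \<le> 9" by (simp flip: exp_add)
      then show "32 * exp 2 * r \<le> 768 * r" using \<open>r > 0\<close> by (intro mult_right_mono) auto
    qed
    finally show "x \<in> elems ?X \<and> nrm ?X x \<le> 768 * r" using F by (auto simp: nrm el)
  next
    fix x assume x: "x \<in> elems ?X"
    then show "0 \<le> nrm ?X x"
      unfolding nrm by (intro cInf_greatest ne) (auto dest: K0)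
  qed simp
qed

subsection \<open>The dual Orlicz space\<close>

lemma continuous_on_dual_orlicz_scaled:
  assumes "c \<ge> 0"
  shows "continuous_on {1..b} (\<lambda>l. dual_orlicz (c / l))"
proof (cases "c = 0")
  case False
  have "1 + max 0 (- ln (c / l)) \<noteq> 0" for l using log_weight_pos[of "c / l"] by (simp add: log_weight_def)
  then show ?thesis
    unfolding dual_orlicz_def log_weight_def using False assms
    by (intro continuous_intros) auto
qed simp

text \<open>Intermediate values between \<open>l = 1\<close> and \<open>l\<close> equal to the sum
  itself, where \<open>dual_orlicz_divide_le\<close> brings the sum down to at most 1. The exact
  value 1 makes the test sequence of the duality argument both admissible and norming.\<close>

lemma exists_scale_sum_dual_orlicz_eq_1:
  assumes "\<And>n. 0 \<le> c n" "1 < (\<Sum>n<N. dual_orlicz (c n))"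
  obtains l where "1 \<le> l" "(\<Sum>n<N. dual_orlicz (c n / l)) = 1"
proof -
  let ?S = "\<lambda>l. \<Sum>n<N. dual_orlicz (c n / l)"
  have "?S (?S 1) \<le> (\<Sum>n<N. dual_orlicz (c n) / ?S 1)"
    using assms by (intro sum_mono dual_orlicz_divide_le) auto
  also have "\<dots> = 1" using assms by (simp flip: sum_divide_distrib)
  finally have "?S (?S 1) \<le> 1" .
  moreover have "continuous_on {1..?S 1} ?S"
    using assms(1) by (intro continuous_on_sum continuous_on_dual_orlicz_scaled)
  ultimately obtain l where "1 \<le> l" "?S l = 1"
    using IVT2'[of ?S "?S 1" 1 1] assms(2) by auto
  then show thesis by (rule that)
qed

text \<open>The formula for \<open>f\<close> holds only below \<open>\<delta>\<close>; beyond it,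
  only monotonicity and convexity are at hand. The arguments are therefore carried back to points
  below \<open>\<delta>\<close>.\<close>

locale log_square_orlicz =
  fixes f :: "real \<Rightarrow> real" and \<delta> :: real
  assumes orlicz: "orlicz_function f" and \<delta>: "0 < \<delta>"
    and f_eq: "\<And>t. 0 < t \<Longrightarrow> t < \<delta> \<Longrightarrow> f t = t\<^sup>2 * (ln t)\<^sup>2"
begin

text \<open>Small enough that \<open>\<kappa> * t / (log_weight t)^2\<close> stays below
  \<open>\<delta>\<close> for \<open>t \<le> 1\<close>, and that minus its logarithm is at least
  \<open>log_weight t\<close>; the bound \<open>exp (- 1)\<close> provides the missing 1 in the
  latter.\<close>

definition \<kappa> :: real where "\<kappa> = min (exp (- 1)) (\<delta> / 2)"

text \<open>The loss in \<open>f_extremal_le\<close>. The maximum with 1 allows division by this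
  constant inside \<open>f\<close> by convexity.\<close>

definition dom_const :: real where "dom_const = max 1 ((\<kappa> * (3 - ln \<kappa>))\<^sup>2)"

lemma \<kappa>: "0 < \<kappa>" "\<kappa> < \<delta>" "1 \<le> - ln \<kappa>"
proof -
  show "0 < \<kappa>" "\<kappa> < \<delta>" using \<delta> by (auto simp: \<kappa>_def)
  then have "ln \<kappa> \<le> ln (exp (- 1))" by (intro ln_mono) (auto simp: \<kappa>_def)
  then show "1 \<le> - ln \<kappa>" by simp
qed

lemma f_0: "f 0 = 0"
  using orlicz by (simp add: orlicz_function_def)

lemma f_mono: "0 \<le> s \<Longrightarrow> s \<le> t \<Longrightarrow> f s \<le> f t"
  using orlicz by (auto simp: orlicz_function_def mono_on_def)

lemma f_nonneg: "0 \<le> t \<Longrightarrow> 0 \<le> f t"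
  using f_mono[of 0 t] by (simp add: f_0)

lemma f_divide_le:
  assumes "0 \<le> t" "1 \<le> c"
  shows "f (t / c) \<le> f t / c"
proof -
  have "f ((1 - 1 / c) *\<^sub>R 0 + (1 / c) *\<^sub>R t) \<le> (1 - 1 / c) * f 0 + (1 / c) * f t"
    using orlicz assms by (intro convex_onD) (auto simp: orlicz_function_def)
  then show ?thesis by (simp add: f_0)
qed

text \<open>The threshold \<open>s0\<close> imitates the maximiser of \<open>s * t - f s\<close>.
  Below it, \<open>s * t\<close> is at most \<open>s0 * t\<close>, which is
  \<open>\<kappa> * dual_orlicz t\<close>. Above it, convexity gives
  \<open>f s / s \<ge> f s0 / s0\<close>, and the explicit formula at \<open>s0\<close> makes this
  at least \<open>\<kappa> * t\<close>.\<close>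

lemma young_inequality:
  assumes s: "0 \<le> s" and t: "0 \<le> t" "t \<le> 1"
  shows "s * t \<le> f s / \<kappa> + \<kappa> * dual_orlicz t"
proof (cases "t = 0")
  case True
  then show ?thesis using f_nonneg[OF s] \<kappa>(1) by simp
next
  case False
  define M where "M = log_weight t"
  define s0 where "s0 = \<kappa> * t / M\<^sup>2"
  have t0: "t > 0" using False t by simp
  have M: "M = 1 - ln t" "M \<ge> 1"
    using log_weight_le_1[OF t0 t(2)] log_weight_ge_1[of t] by (auto simp: M_def)
  have s0: "0 < s0" using t0 M(2) \<kappa>(1) by (simp add: s0_def)
  have "s0 \<le> \<kappa> * 1 / 1"
    unfolding s0_def using t M(2) \<kappa>(1) by (intro frac_le mult_left_mono) auto
  then have s0\<delta>: "s0 < \<delta>" using \<kappa>(2) by simp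
  show ?thesis
  proof (cases "s \<le> s0")
    case True
    then have "s * t \<le> s0 * t" using t by (intro mult_right_mono)
    also have "\<dots> = \<kappa> * dual_orlicz t"
      by (simp add: s0_def dual_orlicz_def M_def power2_eq_square)
    finally show ?thesis using f_nonneg[OF s] \<kappa>(1) by (simp add: add_increasing)
  next
    case False
    have "ln s0 = ln \<kappa> + ln t - 2 * ln M"
      using t0 M(2) \<kappa>(1) by (simp add: s0_def ln_div ln_mult ln_realpow)
    moreover have "0 \<le> ln M" using M(2) by simp
    ultimately have "M \<le> - ln s0" using \<kappa>(3) M(1) by linarith
    then have "M\<^sup>2 \<le> (ln s0)\<^sup>2" using M(2) power_mono[of M "- ln s0" 2] by simp
    then have "s0 * (s0 * M\<^sup>2) \<le> f s0"
      using s0 by (simp add: f_eq[OF s0 s0\<delta>] power2_eq_square mult_left_mono mult.assoc)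
    moreover have "s0 * M\<^sup>2 = \<kappa> * t" using M(2) by (simp add: s0_def)
    moreover have "f s0 \<le> f s / (s / s0)"
      using f_divide_le[OF s, of "s / s0"] False s0 by simp
    ultimately have "s0 * (\<kappa> * t) \<le> s0 * (f s / s)" by (simp add: mult.commute)
    then have "\<kappa> * t \<le> f s / s" using s0 by (simp only: mult_le_cancel_left_pos)
    then have "s * t \<le> f s / \<kappa>" using False s0 \<kappa>(1) by (simp add: field_simps)
    then show ?thesis using \<kappa>(1) dual_orlicz_nonneg[of t] by (simp add: add_increasing2)
  qed
qed

text \<open>Near-equality in Young's inequality at the same point \<open>s0\<close>, whose product
  with \<open>t\<close> is \<open>\<kappa> * dual_orlicz t\<close>. The estimate
  \<open>ln M \<le> M - 1\<close> shows that the logarithm of \<open>s0\<close> exceeds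
  \<open>M\<close> in size by at most a constant factor.\<close>

lemma f_extremal_le:
  assumes t: "0 \<le> t" "t \<le> 1"
  shows "f (\<kappa> * t / (log_weight t)\<^sup>2) \<le> dom_const * dual_orlicz t"
proof (cases "t = 0")
  case False
  define M where "M = log_weight t"
  define s0 where "s0 = \<kappa> * t / M\<^sup>2"
  have t0: "t > 0" using False t by simp
  have M: "M = 1 - ln t" "M \<ge> 1"
    using log_weight_le_1[OF t0 t(2)] log_weight_ge_1[of t] by (auto simp: M_def)
  have s0: "0 < s0" using t0 M(2) \<kappa>(1) by (simp add: s0_def)
  have "s0 \<le> \<kappa> * 1 / 1"
    unfolding s0_def using t M(2) \<kappa>(1) by (intro frac_le mult_left_mono) auto
  then have s0\<delta>: "s0 < \<delta>" "s0 \<le> \<kappa>" using \<kappa>(2) by auto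
  have lns0: "ln s0 = ln \<kappa> + ln t - 2 * ln M"
    using t0 M(2) \<kappa>(1) by (simp add: s0_def ln_div ln_mult ln_realpow)
  have "- ln \<kappa> \<le> M * (- ln \<kappa>)" using mult_right_mono[OF M(2), of "- ln \<kappa>"] \<kappa>(3) by simp
  moreover have "ln M \<le> M - 1" using M(2) by (intro ln_le_minus_one) simp
  moreover have "M * (3 - ln \<kappa>) = 3 * M + M * (- ln \<kappa>)" by (simp add: algebra_simps)
  ultimately have "- ln s0 \<le> M * (3 - ln \<kappa>)" using M(1) lns0 by linarith
  moreover have "0 \<le> - ln s0"
  proof -
    have "ln s0 \<le> ln \<kappa>" using s0 s0\<delta>(2) by (intro ln_mono) auto
    then show ?thesis using \<kappa>(3) by linarith
  qed
  ultimately have "(- ln s0)\<^sup>2 \<le> (M * (3 - ln \<kappa>))\<^sup>2" by (intro power_mono)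
  then have "f s0 \<le> s0\<^sup>2 * (M * (3 - ln \<kappa>))\<^sup>2"
    by (simp add: f_eq[OF s0 s0\<delta>(1)] mult_left_mono)
  also have "\<dots> = (\<kappa> * (3 - ln \<kappa>))\<^sup>2 * dual_orlicz t"
    using M(2) by (simp add: s0_def dual_orlicz_def M_def[symmetric] power2_eq_square field_simps)
  also have "\<dots> \<le> dom_const * dual_orlicz t"
    by (intro mult_right_mono dual_orlicz_nonneg) (simp add: dom_const_def)
  finally show ?thesis by (simp add: s0_def M_def)
qed (simp add: f_0)

section \<open>Duality between the Orlicz spaces of \<open>f\<close> and of
  \<open>dual_orlicz\<close>\<close>

abbreviation \<F> :: seq_space where "\<F> \<equiv> orlicz_space f"

definition radii :: "(nat \<Rightarrow> complex) \<Rightarrow> real set" where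
  "radii x = {r. r > 0 \<and> summable (\<lambda>n. f (cmod (x n) / r)) \<and> (\<Sum>n. f (cmod (x n) / r)) \<le> 1}"

lemma nrm_eq_Inf_radii: "nrm \<F> x = Inf (radii x)"
  by (simp add: orlicz_space_def radii_def)

lemma bdd_below_radii: "bdd_below (radii x)"
  by (rule bdd_belowI[of _ 0]) (simp add: radii_def)

lemma radii_nonempty:
  assumes "x \<in> elems \<F>"
  shows "radii x \<noteq> {}"
proof -
  obtain r where r: "r > 0" "summable (\<lambda>n. f (cmod (x n) / r))"
    using assms by (auto simp: orlicz_space_def)
  define S where "S = max 1 (\<Sum>n. f (cmod (x n) / r))"
  have S: "S \<ge> 1" by (simp add: S_def)
  have le: "f (cmod (x n) / r / S) \<le> f (cmod (x n) / r) / S" for n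
    using r S by (intro f_divide_le) auto
  have sm: "summable (\<lambda>n. f (cmod (x n) / r / S))"
    using le r S f_nonneg
    by (intro summable_comparison_test'[OF summable_divide[OF r(2), of S]]) (auto simp: abs_of_nonneg)
  have "(\<Sum>n. f (cmod (x n) / r / S)) \<le> (\<Sum>n. f (cmod (x n) / r) / S)"
    by (intro suminf_le le sm summable_divide r)
  also have "\<dots> = (\<Sum>n. f (cmod (x n) / r)) / S" by (rule suminf_divide[OF r(2)])
  also have "\<dots> \<le> 1" using S by (simp add: divide_le_eq S_def)
  finally have "r * S \<in> radii x" using r S sm by (simp add: radii_def)
  then show ?thesis by blast
qed

lemma nrm_nonneg: "x \<in> elems \<F> \<Longrightarrow> 0 \<le> nrm \<F> x"
  unfolding nrm_eq_Inf_radii by (intro cInf_greatest radii_nonempty) (auto simp: radii_def)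

lemma nrm_le: "r \<in> radii x \<Longrightarrow> nrm \<F> x \<le> r"
  unfolding nrm_eq_Inf_radii by (rule cInf_lower[OF _ bdd_below_radii])

lemma radii_subset_elems: "r \<in> radii x \<Longrightarrow> x \<in> elems \<F>"
  by (auto simp: radii_def orlicz_space_def)

lemma zero_in_elems: "(\<lambda>n. 0) \<in> elems \<F>" "nrm \<F> (\<lambda>n. 0) \<le> 1"
proof -
  have "1 \<in> radii (\<lambda>n. 0)" by (simp add: radii_def f_0)
  then show "(\<lambda>n. 0) \<in> elems \<F>" "nrm \<F> (\<lambda>n. 0) \<le> 1"
    using radii_subset_elems nrm_le by blast+
qed

lemma pairing_le:
  assumes r: "r > 0" and w: "in_unit_ball (\<lambda>n. w n / of_real r)" and x: "x \<in> elems \<F>"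
  shows "summable (\<lambda>n. x n * w n)"
    and "cmod (\<Sum>n. x n * w n) \<le> (1 / \<kappa> + \<kappa>) * r * nrm \<F> x"
proof -
  let ?g = "\<lambda>n. dual_orlicz (cmod (w n / of_real r))"
  have sg: "summable ?g" "suminf ?g \<le> 1" using w by auto
  \<comment> \<open>Young's inequality is available for \<open>t \<le> 1\<close> only; a modular at
    most 1 forces every entry into this range.\<close>
  have w1: "cmod (w n / of_real r) \<le> 1" for n
  proof (rule dual_orlicz_le_1_imp)
    have "sum ?g {n} \<le> suminf ?g" by (intro sum_le_suminf sg) (auto simp: dual_orlicz_nonneg)
    then show "?g n \<le> 1" using sg by simp
  qed simp
  \<comment> \<open>Proved for each admissible radius and carried to the infimum afterwards, since
    the infimum is not attained at \<open>x = 0\<close>.\<close>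
  have *: "summable (\<lambda>n. x n * w n) \<and> cmod (\<Sum>n. x n * w n) \<le> (1 / \<kappa> + \<kappa>) * r * \<rho>"
    if "\<rho> \<in> radii x" for \<rho>
  proof -
    have \<rho>: "\<rho> > 0" "summable (\<lambda>n. f (cmod (x n) / \<rho>))" "(\<Sum>n. f (cmod (x n) / \<rho>)) \<le> 1"
      using that by (auto simp: radii_def)
    let ?h = "\<lambda>n. \<rho> * r * (f (cmod (x n) / \<rho>) / \<kappa> + \<kappa> * ?g n)"
    have le: "cmod (x n * w n) \<le> ?h n" for n
    proof -
      have "cmod (x n * w n) = \<rho> * r * (cmod (x n) / \<rho> * cmod (w n / of_real r))"
        using \<rho>(1) r by (simp add: norm_mult norm_divide)
      also have "\<dots> \<le> ?h n"
        using \<rho>(1) r w1[of n] by (intro mult_left_mono young_inequality) auto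
      finally show ?thesis .
    qed
    have sh: "summable ?h"
      by (intro summable_mult summable_add summable_divide \<rho>(2) sg(1))
    have sn: "summable (\<lambda>n. cmod (x n * w n))"
      by (rule summable_comparison_test'[OF sh]) (use le in simp)
    have "cmod (\<Sum>n. x n * w n) \<le> (\<Sum>n. cmod (x n * w n))" by (rule summable_norm[OF sn])
    also have "\<dots> \<le> suminf ?h" by (intro suminf_le le sn sh)
    also have "\<dots> = \<rho> * r * ((\<Sum>n. f (cmod (x n) / \<rho>)) / \<kappa> + \<kappa> * suminf ?g)"
      using \<rho>(2) sg(1)
      by (simp add: suminf_mult suminf_add[symmetric] suminf_divide summable_add summable_divide summable_mult)
    also have "\<dots> \<le> \<rho> * r * (1 / \<kappa> + \<kappa> * 1)"
      using \<rho> r \<kappa>(1) sg by (intro mult_left_mono add_mono divide_right_mono) auto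
    finally show ?thesis using summable_norm_cancel[OF sn] by (simp add: mult_ac)
  qed
  obtain \<rho> where "\<rho> \<in> radii x" using radii_nonempty[OF x] by blast
  with * show "summable (\<lambda>n. x n * w n)" by blast
  have c: "(1 / \<kappa> + \<kappa>) * r > 0" using \<kappa>(1) r by (simp add: add_pos_pos)
  have "cmod (\<Sum>n. x n * w n) / ((1 / \<kappa> + \<kappa>) * r) \<le> Inf (radii x)"
    using * c by (intro cInf_greatest radii_nonempty[OF x]) (simp add: divide_le_eq mult_ac)
  then show "cmod (\<Sum>n. x n * w n) \<le> (1 / \<kappa> + \<kappa>) * r * nrm \<F> x"
    using c by (simp add: nrm_eq_Inf_radii divide_le_eq mult_ac)
qed

lemma dual_space_upper:
  assumes r: "r > 0" and w: "in_unit_ball (\<lambda>n. w n / of_real r)"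
  shows "w \<in> elems (dual_space \<F>)" and "nrm (dual_space \<F>) w \<le> (1 / \<kappa> + \<kappa>) * r"
proof -
  let ?\<phi> = "\<lambda>x. \<Sum>n. x n * w n"
  note pair = pairing_le[OF r w]
  have "bounded_functional \<F> ?\<phi>"
    unfolding bounded_functional_def
  proof (intro conjI ballI allI)
    fix x y assume "x \<in> elems \<F>" "y \<in> elems \<F>"
    then show "?\<phi> (\<lambda>n. x n + y n) = ?\<phi> x + ?\<phi> y"
      using pair(1) by (simp add: suminf_add distrib_right)
  next
    fix c x assume "x \<in> elems \<F>"
    then show "?\<phi> (\<lambda>n. c * x n) = c * ?\<phi> x"
      using pair(1) suminf_mult[of "\<lambda>n. x n * w n" c] by (simp add: mult.assoc)
  qed (use pair(2) in blast)
  moreover have "(\<lambda>n. x n * w n) sums ?\<phi> x" if "x \<in> elems \<F>" for x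
    by (rule summable_sums[OF pair(1)[OF that]])
  ultimately show "w \<in> elems (dual_space \<F>)" by (auto simp: dual_space_def)
  have c: "(1 / \<kappa> + \<kappa>) * r > 0" using \<kappa>(1) r by (simp add: add_pos_pos)
  have "functional_norm \<F> ?\<phi> \<le> (1 / \<kappa> + \<kappa>) * r"
    unfolding functional_norm_def
  proof (rule cSUP_least)
    show "{x \<in> elems \<F>. nrm \<F> x \<le> 1} \<noteq> {}" using zero_in_elems by blast
    fix x assume x: "x \<in> {x \<in> elems \<F>. nrm \<F> x \<le> 1}"
    then have "(1 / \<kappa> + \<kappa>) * r * nrm \<F> x \<le> (1 / \<kappa> + \<kappa>) * r * 1"
      using c by (intro mult_left_mono) auto
    then show "cmod (?\<phi> x) \<le> (1 / \<kappa> + \<kappa>) * r" using pair(2)[of x] x by simp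
  qed
  then show "nrm (dual_space \<F>) w \<le> (1 / \<kappa> + \<kappa>) * r" by (simp add: dual_space_def)
qed

text \<open>The supremum in \<open>functional_norm\<close> dominates its members only once they are
  known to be bounded. The functional that witnesses membership in the dual supplies the bound; its
  absolute value is taken because the sign of \<open>B\<close> is not prescribed.\<close>

lemma pairing_le_nrm_dual:
  assumes y: "y \<in> elems (dual_space \<F>)" and x: "x \<in> elems \<F>" "nrm \<F> x \<le> 1"
  shows "cmod (\<Sum>n. x n * y n) \<le> nrm (dual_space \<F>) y"
proof -
  obtain \<phi> B where \<phi>: "\<And>x. x \<in> elems \<F> \<Longrightarrow> (\<lambda>n. x n * y n) sums \<phi> x"
    "\<And>x. x \<in> elems \<F> \<Longrightarrow> cmod (\<phi> x) \<le> B * nrm \<F> x"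
    using y by (auto simp: dual_space_def bounded_functional_def) metis
  have "cmod (\<Sum>n. x n * y n) \<le> \<bar>B\<bar>" if "x \<in> elems \<F>" "nrm \<F> x \<le> 1" for x
  proof -
    have "cmod (\<Sum>n. x n * y n) \<le> B * nrm \<F> x"
      using \<phi>(2)[OF that(1)] sums_unique[OF \<phi>(1)[OF that(1)]] by simp
    also have "\<dots> \<le> \<bar>B\<bar> * nrm \<F> x" using nrm_nonneg[OF that(1)] by (intro mult_right_mono) auto
    also have "\<dots> \<le> \<bar>B\<bar> * 1" using that by (intro mult_left_mono) auto
    finally show ?thesis by simp
  qed
  then have "bdd_above ((\<lambda>x. cmod (\<Sum>n. x n * y n)) ` {x \<in> elems \<F>. nrm \<F> x \<le> 1})"
    by (intro bdd_aboveI[of _ "\<bar>B\<bar>"]) auto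
  then show ?thesis
    using x by (auto simp: dual_space_def functional_norm_def intro!: cSUP_upper)
qed

text \<open>If finitely many entries of \<open>y / r\<close> had modular above 1, scaling by some
  \<open>l \<ge> 1\<close> would make it exactly 1. Testing \<open>y\<close> on the near-extremal
  points of Young's inequality, a finitely supported sequence, then yields
  \<open>l * r * \<kappa> / dom_const\<close>, more than the dual norm permits.\<close>

lemma dual_space_lower:
  assumes y: "y \<in> elems (dual_space \<F>)" and r: "r > 0" "dom_const / \<kappa> * nrm (dual_space \<F>) y < r"
  shows "in_unit_ball (\<lambda>n. y n / of_real r)"
proof -
  have D: "dom_const \<ge> 1" by (simp add: dom_const_def)
  have "(\<Sum>n<N. dual_orlicz (cmod (y n / of_real r))) \<le> 1" for N
  proof (rule ccontr)
    let ?c = "\<lambda>n. cmod (y n / of_real r)"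
    assume "\<not> (\<Sum>n<N. dual_orlicz (?c n)) \<le> 1"
    then obtain l where l: "1 \<le> l" "(\<Sum>n<N. dual_orlicz (?c n / l)) = 1"
      using exists_scale_sum_dual_orlicz_eq_1[of ?c N] by auto
    define t where "t = (\<lambda>n. ?c n / l)"
    have t0: "t n \<ge> 0" for n using l by (simp add: t_def)
    have sumt: "(\<Sum>n<N. dual_orlicz (t n)) = 1" using l by (simp add: t_def)
    have t1: "t n \<le> 1" if "n < N" for n
    proof (rule dual_orlicz_le_1_imp[OF t0])
      show "dual_orlicz (t n) \<le> 1"
        using member_le_sum[of n "{..<N}" "\<lambda>n. dual_orlicz (t n)"] that sumt dual_orlicz_nonneg by auto
    qed
    define s where "s = (\<lambda>n. \<kappa> * t n / (log_weight (t n))\<^sup>2)"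
    have s0: "s n \<ge> 0" for n using \<kappa>(1) t0[of n] by (simp add: s_def)
    \<comment> \<open>The pairing is bilinear, so the conjugate sign makes every product
      \<open>x n * y n\<close> nonnegative. Division by \<open>dom_const\<close> absorbs the loss in
      \<open>f_extremal_le\<close> and puts \<open>x\<close> in the unit ball.\<close>
    define x where "x = (\<lambda>n. if n < N then of_real (s n / dom_const) * cnj (sgn (y n)) else 0)"
    have nx: "cmod (x n) \<le> s n / dom_const" "n \<ge> N \<Longrightarrow> x n = 0" for n
      using s0[of n] D by (auto simp: x_def norm_mult norm_divide norm_sgn)
    have fx: "f (cmod (x n)) \<le> dual_orlicz (t n)" if "n < N" for n
    proof -
      have "f (cmod (x n)) \<le> f (s n / dom_const)" by (intro f_mono nx) simp
      also have "\<dots> \<le> f (s n) / dom_const" by (intro f_divide_le s0 D)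
      also have "\<dots> \<le> dom_const * dual_orlicz (t n) / dom_const"
        unfolding s_def using D by (intro divide_right_mono f_extremal_le t0 t1 that) auto
      finally show ?thesis using D by simp
    qed
    have "(\<lambda>n. f (cmod (x n))) sums (\<Sum>n<N. f (cmod (x n)))"
      by (rule sums_finite) (auto simp: nx(2) f_0)
    moreover have "(\<Sum>n<N. f (cmod (x n))) \<le> 1"
      using sum_mono[of "{..<N}" "\<lambda>n. f (cmod (x n))" "\<lambda>n. dual_orlicz (t n)"] fx sumt by simp
    ultimately have "1 \<in> radii x" by (simp add: radii_def sums_iff)
    then have "cmod (\<Sum>n. x n * y n) \<le> nrm (dual_space \<F>) y"
      using pairing_le_nrm_dual[OF y] radii_subset_elems nrm_le by blast
    moreover have "(\<Sum>n. x n * y n) = of_real (l * r * \<kappa> / dom_const)"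
    proof -
      have "x n * y n = of_real (l * r * \<kappa> / dom_const * dual_orlicz (t n))" if "n < N" for n
      proof -
        have "cnj (sgn (y n)) * y n = of_real (cmod (y n))"
          by (cases "y n = 0") (simp_all add: sgn_eq complex_norm_square[symmetric] power2_eq_square mult.commute flip: complex_mult_cnj)
        moreover have "cmod (y n) = l * r * t n" using l r by (simp add: t_def norm_divide)
        ultimately have "x n * y n = of_real (s n / dom_const * (l * r * t n))"
          using that by (simp add: x_def mult.assoc)
        also have "s n / dom_const * (l * r * t n) = l * r * \<kappa> / dom_const * dual_orlicz (t n)"
          by (simp add: s_def dual_orlicz_def power2_eq_square mult_ac)
        finally show ?thesis .
      qed
      then have "(\<Sum>n<N. x n * y n) = (\<Sum>n<N. of_real (l * r * \<kappa> / dom_const * dual_orlicz (t n)))"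
        by (intro sum.cong) auto
      also have "\<dots> = of_real (l * r * \<kappa> / dom_const * (\<Sum>n<N. dual_orlicz (t n)))"
        by (simp only: sum_distrib_left of_real_sum)
      also have "\<dots> = of_real (l * r * \<kappa> / dom_const)" by (simp add: sumt)
      finally show ?thesis
        using sums_finite[of "{..<N}" "\<lambda>n. x n * y n"] by (simp add: nx(2) sums_iff)
    qed
    ultimately have "l * r * \<kappa> / dom_const \<le> nrm (dual_space \<F>) y"
      by (simp only: norm_of_real)
    then have "dom_const / \<kappa> * (l * r * \<kappa> / dom_const) \<le> dom_const / \<kappa> * nrm (dual_space \<F>) y"
      using D \<kappa>(1) by (intro mult_left_mono) auto
    moreover have "dom_const / \<kappa> * (l * r * \<kappa> / dom_const) = l * r" using D \<kappa>(1) by simp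
    ultimately have "l * r < r" using r(2) by linarith
    then show False using l r by simp
  qed
  then show ?thesis using in_unit_ballI[of 1 "\<lambda>n. y n / of_real r" 1] by simp
qed

lemma dual_space_eq: "dual_space \<F> \<cong>\<^sub>s orlicz_space dual_orlicz"
proof -
  let ?C = "max (dom_const / \<kappa>) (1 / \<kappa> + \<kappa>)"
  have nonneg: "0 \<le> nrm (dual_space \<F>) y" if "y \<in> elems (dual_space \<F>)" for y
    using pairing_le_nrm_dual[OF that zero_in_elems] by simp
  show ?thesis
  proof (rule seq_space_eq_orlicz_dualI[OF _ _ _ nonneg])
    show "?C > 0" using \<kappa>(1) by (simp add: less_max_iff_disj add_pos_pos)
    fix y and r :: real assume y: "y \<in> elems (dual_space \<F>)" and r: "r > 0" "?C * nrm (dual_space \<F>) y < r"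
    have "dom_const / \<kappa> * nrm (dual_space \<F>) y \<le> ?C * nrm (dual_space \<F>) y"
      by (intro mult_right_mono nonneg y) simp
    then show "in_unit_ball (\<lambda>n. y n / of_real r)"
      using r by (intro dual_space_lower y) auto
  next
    fix w and r :: real assume r: "r > 0" and w: "in_unit_ball (\<lambda>n. w n / of_real r)"
    have "(1 / \<kappa> + \<kappa>) * r \<le> ?C * r" using r by (intro mult_right_mono) auto
    then show "w \<in> elems (dual_space \<F>) \<and> nrm (dual_space \<F>) w \<le> ?C * r"
      using dual_space_upper[OF r w] by auto
  qed
qed

end

lemma dual_space_orlicz_space_eq:
  assumes "orlicz_function f" "\<forall>\<^sub>F t in at_right 0. f t = t\<^sup>2 * (ln t)\<^sup>2"
  shows "dual_space (orlicz_space f) \<cong>\<^sub>s orlicz_space dual_orlicz"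
proof -
  obtain \<delta> where "0 < \<delta>" "\<And>t. 0 < t \<Longrightarrow> t < \<delta> \<Longrightarrow> f t = t\<^sup>2 * (ln t)\<^sup>2"
    using assms(2) by (auto simp: eventually_at_right_field)
  then interpret log_square_orlicz f \<delta> by unfold_locales (use assms(1) in auto)
  show ?thesis by (rule dual_space_eq)
qed

theorem proposition5p6:
  fixes f :: "real \<Rightarrow> real"
  assumes "orlicz_function f"
    and "\<forall>\<^sub>F t in at_right 0. f t = t\<^sup>2 * (ln t)\<^sup>2"
  shows "image_space ell_inf ell_1 (Delta ell_inf ell_1 2) (ker_Delta ell_inf ell_1 1)
           \<cong>\<^sub>s image_space ell_inf ell_1 (Delta ell_inf ell_1 2) (ker_Delta ell_inf ell_1 0) \<and>
         image_space ell_inf ell_1 (Delta ell_inf ell_1 2) (ker_Delta ell_inf ell_1 0)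
           \<cong>\<^sub>s dual_space (orlicz_space f)"
proof
  note image = image_space_Delta_2_eq[of 0] image_space_Delta_2_eq[of 1]
  note dual = dual_space_orlicz_space_eq[OF assms]
  show "image_space ell_inf ell_1 (Delta ell_inf ell_1 2) (ker_Delta ell_inf ell_1 1)
           \<cong>\<^sub>s image_space ell_inf ell_1 (Delta ell_inf ell_1 2) (ker_Delta ell_inf ell_1 0)"
    using seq_space_eq_trans[OF image(2) seq_space_eq_sym[OF image(1)]] by simp
  show "image_space ell_inf ell_1 (Delta ell_inf ell_1 2) (ker_Delta ell_inf ell_1 0)
           \<cong>\<^sub>s dual_space (orlicz_space f)"
    using seq_space_eq_trans[OF image(1) seq_space_eq_sym[OF dual]] by simp
qed

end
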